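(* Let $(\Omega_i,S_i,\mu_i)$, $i=1,\dots,n$, be $\sigma$-finite measure spaces, let $\Omega=\prod_{i=1}^n\Omega_i$, and let $P=(p_1,\dots,p_n)$ with $1\le p_i<\infty$ for all $i$. Let $w$ be a strictly positive measurable function on $\Omega$ such that $$w(x_1,\dots,x_n)\le w_1(x_1)\cdots w_n(x_n)\qquad\text{for all }x=(x_1,\dots,x_n)\in\Omega ,$$ where, for each $j=1,\dots,n$, $w_j$ is a weight on $\Omega_j$, i.e. a strictly positive locally integrable function on $\Omega_j$. Then the weighted mixed-norm space $L_w^P=L_w^{(p_1,\dots,p_n)}$ has the metric approximation property.
   Context: For a measurable function $f$ on the product measure space $\Omega$, $$\|f\|_{L_w^P}:=\left(\int_{\Omega_n}\cdots\left(\int_{\Omega_2}\left(\int_{\Omega_1}|f(x)|^{p_1}w(x)\,d\mu_1(x_1)\right)^{\frac{p_2}{p_1}}d\mu_2(x_2)\right)^{\frac{p_3}{p_2}}\cdots d\mu_n(x_n)\right)^{\frac1{p_n}},$$ and $L_w^P$ is the Banach space of (a.e. classes of) measurable functions $f$ with $\|f\|_{L_w^P}<\infty$. The order of integration matters. A Banach space $\mathcal B$ has the metric approximation property if for every compact set $K\subset\mathcal B$ and every $\epsilon>0$ there exists a bounded finite rank linear operator $F:\mathcal B\to\mathcal B$ with $\|F\|\le 1$ and $\|x-Fx\|<\epsilon$ for every $x\in K$. *)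

theory Defs
  imports "HOL-Analysis.Analysis"
begin

section \<open>Normed spaces on a carrier and the metric approximation property\<close>

text \<open>
  \<open>L_w\<^sup>P\<close> depends on measures and exponents, so it is a structure on a carrier set rather than a type.
\<close>

record ('k, 'v) normed_structure =
  vcarrier :: "'v set"
  vadd :: "'v \<Rightarrow> 'v \<Rightarrow> 'v"
  vzero :: "'v"
  vscale :: "'k \<Rightarrow> 'v \<Rightarrow> 'v"
  vnorm :: "'v \<Rightarrow> real"

definition vdiff :: "('k::ring_1, 'v) normed_structure \<Rightarrow> 'v \<Rightarrow> 'v \<Rightarrow> 'v" where
  "vdiff B x y = vadd B x (vscale B (- 1) y)"

text \<open>
  The locale \<open>Metric_space\<close> wants a total symmetric nonnegative distance; its values off the
  carrier do not influence the topology.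
\<close>

definition vdist :: "('k::ring_1, 'v) normed_structure \<Rightarrow> 'v \<Rightarrow> 'v \<Rightarrow> real" where
  "vdist B x y = (if x \<in> vcarrier B \<and> y \<in> vcarrier B then vnorm B (vdiff B x y) else 0)"

abbreviation vtopology :: "('k::ring_1, 'v) normed_structure \<Rightarrow> 'v topology" where
  "vtopology B \<equiv> Metric_space.mtopology (vcarrier B) (vdist B)"

definition vsubspace :: "('k, 'v) normed_structure \<Rightarrow> 'v set \<Rightarrow> bool" where
  "vsubspace B V \<longleftrightarrow> V \<subseteq> vcarrier B \<and> vzero B \<in> V \<and>
     (\<forall>x\<in>V. \<forall>y\<in>V. vadd B x y \<in> V) \<and> (\<forall>c. \<forall>x\<in>V. vscale B c x \<in> V)"

definition vspan :: "('k, 'v) normed_structure \<Rightarrow> 'v set \<Rightarrow> 'v set" where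
  "vspan B S = vsubspace B hull S"

definition linear_operator :: "('k, 'v) normed_structure \<Rightarrow> ('v \<Rightarrow> 'v) \<Rightarrow> bool" where
  "linear_operator B F \<longleftrightarrow> F \<in> vcarrier B \<rightarrow> vcarrier B \<and>
     (\<forall>x\<in>vcarrier B. \<forall>y\<in>vcarrier B. F (vadd B x y) = vadd B (F x) (F y)) \<and>
     (\<forall>c. \<forall>x\<in>vcarrier B. F (vscale B c x) = vscale B c (F x))"

definition bounded_operator :: "('k, 'v) normed_structure \<Rightarrow> ('v \<Rightarrow> 'v) \<Rightarrow> bool" where
  "bounded_operator B F \<longleftrightarrow> (\<exists>C. \<forall>x\<in>vcarrier B. vnorm B (F x) \<le> C * vnorm B x)"

definition finite_rank :: "('k, 'v) normed_structure \<Rightarrow> ('v \<Rightarrow> 'v) \<Rightarrow> bool" where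
  "finite_rank B F \<longleftrightarrow> (\<exists>S. finite S \<and> S \<subseteq> vcarrier B \<and> F ` vcarrier B \<subseteq> vspan B S)"

definition operator_norm :: "('k, 'v) normed_structure \<Rightarrow> ('v \<Rightarrow> 'v) \<Rightarrow> real" where
  "operator_norm B F = (SUP x\<in>{x \<in> vcarrier B. vnorm B x \<le> 1}. vnorm B (F x))"

definition metric_approximation_property :: "('k::ring_1, 'v) normed_structure \<Rightarrow> bool" where
  "metric_approximation_property B \<longleftrightarrow>
     (\<forall>K \<epsilon>. compactin (vtopology B) K \<and> 0 < \<epsilon> \<longrightarrow>
        (\<exists>F. linear_operator B F \<and> bounded_operator B F \<and> finite_rank B F \<and>
             operator_norm B F \<le> 1 \<and> (\<forall>x\<in>K. vnorm B (vdiff B x (F x)) < \<epsilon>)))"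


section \<open>Weighted mixed-norm spaces\<close>

text \<open>Meant for exponents \<open>r > 0\<close>.\<close>

definition ennreal_powr :: "ennreal \<Rightarrow> real \<Rightarrow> ennreal" where
  "ennreal_powr a r = (if a = \<infinity> then \<infinity> else ennreal (enn2real a powr r))"

text \<open>
  \<open>mixed_integral M p w f k x\<close> is the integral over the coordinates \<open>1, \<dots>, k\<close>, innermost first,
  as a function of the remaining coordinates of \<open>x\<close>.
\<close>

fun mixed_integral :: "(nat \<Rightarrow> 'a measure) \<Rightarrow> (nat \<Rightarrow> real) \<Rightarrow> ((nat \<Rightarrow> 'a) \<Rightarrow> real) \<Rightarrow>
    ((nat \<Rightarrow> 'a) \<Rightarrow> 'k::real_normed_vector) \<Rightarrow> nat \<Rightarrow> (nat \<Rightarrow> 'a) \<Rightarrow> ennreal" where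
  "mixed_integral M p w f 0 x = ennreal (norm (f x) powr p 1 * w x)"
| "mixed_integral M p w f (Suc 0) x = (\<integral>\<^sup>+ t. mixed_integral M p w f 0 (x(1 := t)) \<partial>M 1)"
| "mixed_integral M p w f (Suc (Suc k)) x =
     (\<integral>\<^sup>+ t. ennreal_powr (mixed_integral M p w f (Suc k) (x(Suc (Suc k) := t)))
                          (p (Suc (Suc k)) / p (Suc k)) \<partial>M (Suc (Suc k)))"

text \<open>
  All coordinates \<open>1, \<dots>, n\<close> of the base point get overwritten, and elements of
  \<open>space (Pi\<^sub>M {1..n} M)\<close> are \<open>undefined\<close> at every other index.
\<close>

definition mixed_norm :: "nat \<Rightarrow> (nat \<Rightarrow> 'a measure) \<Rightarrow> (nat \<Rightarrow> real) \<Rightarrow> ((nat \<Rightarrow> 'a) \<Rightarrow> real) \<Rightarrow>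
    ((nat \<Rightarrow> 'a) \<Rightarrow> 'k::real_normed_vector) \<Rightarrow> ennreal" where
  "mixed_norm n M p w f = ennreal_powr (mixed_integral M p w f n (\<lambda>_. undefined)) (1 / p n)"

definition mixed_lp_functions :: "nat \<Rightarrow> (nat \<Rightarrow> 'a measure) \<Rightarrow> (nat \<Rightarrow> real) \<Rightarrow>
    ((nat \<Rightarrow> 'a) \<Rightarrow> real) \<Rightarrow> ((nat \<Rightarrow> 'a) \<Rightarrow> 'k::real_normed_vector) set" where
  "mixed_lp_functions n M p w =
     {f \<in> borel_measurable (Pi\<^sub>M {1..n} M). mixed_norm n M p w f < \<infinity>}"

definition mixed_lp_rel :: "nat \<Rightarrow> (nat \<Rightarrow> 'a measure) \<Rightarrow> (nat \<Rightarrow> real) \<Rightarrow> ((nat \<Rightarrow> 'a) \<Rightarrow> real) \<Rightarrow>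
    (((nat \<Rightarrow> 'a) \<Rightarrow> 'k::real_normed_vector) \<times> ((nat \<Rightarrow> 'a) \<Rightarrow> 'k)) set" where
  "mixed_lp_rel n M p w =
     {(f, g). f \<in> mixed_lp_functions n M p w \<and> g \<in> mixed_lp_functions n M p w \<and>
              (AE x in Pi\<^sub>M {1..n} M. f x = g x)}"

definition mixed_lp_space :: "nat \<Rightarrow> (nat \<Rightarrow> 'a measure) \<Rightarrow> (nat \<Rightarrow> real) \<Rightarrow> ((nat \<Rightarrow> 'a) \<Rightarrow> real) \<Rightarrow>
    ('k::real_normed_field, ((nat \<Rightarrow> 'a) \<Rightarrow> 'k) set) normed_structure" where
  "mixed_lp_space n M p w =
     (let R = mixed_lp_rel n M p w in
      \<lparr> vcarrier = mixed_lp_functions n M p w // R,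
        vadd = (\<lambda>X Y. \<Union>f\<in>X. \<Union>g\<in>Y. R `` {\<lambda>x. f x + g x}),
        vzero = R `` {\<lambda>_. 0},
        vscale = (\<lambda>c X. \<Union>f\<in>X. R `` {\<lambda>x. c * f x}),
        vnorm = (\<lambda>X. the_elem ((\<lambda>f. enn2real (mixed_norm n M p w f)) ` X)) \<rparr>)"


section \<open>Weights\<close>

text \<open>
  On an abstract measure space, local integrability refers to a choice of local sets, so this choice
  is kept as a parameter. Taking \<open>\<L>\<close> to be the compact sets (for a Borel measure on a Hausdorff
  space) or the measurable sets of finite measure (for a \<open>\<sigma>\<close>-finite measure) gives the usual notions.
\<close>

definition local_sets :: "'a measure \<Rightarrow> 'a set set \<Rightarrow> bool" where
  "local_sets M \<L> \<longleftrightarrow> \<L> \<subseteq> sets M \<and> \<Union>\<L> = space M"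

definition locally_integrable :: "'a measure \<Rightarrow> 'a set set \<Rightarrow> ('a \<Rightarrow> real) \<Rightarrow> bool" where
  "locally_integrable M \<L> v \<longleftrightarrow> v \<in> borel_measurable M \<and> (\<forall>A\<in>\<L>. set_integrable M A v)"

definition weight :: "'a measure \<Rightarrow> 'a set set \<Rightarrow> ('a \<Rightarrow> real) \<Rightarrow> bool" where
  "weight M \<L> v \<longleftrightarrow> locally_integrable M \<L> v \<and> (\<forall>t\<in>space M. 0 < v t)"

end

theory Submission
  imports Defs
begin

text \<open>
  Since \<open>w\<close> is strictly positive, \<open>f \<mapsto> w\<^bsup>1/p\<^sub>1\<^esup> f\<close> is a linear isometry of \<open>L\<^sub>w\<^sup>P\<close> onto the
  unweighted space \<open>L\<^sup>P\<close>. On \<open>L\<^sup>P\<close> the finite rank operators are the averaging operators over finite families of disjoint boxes, every side of which runs through a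
  finite disjoint family of sets of finite measure. The absolute value of such an average is bounded
  by an integral against a product of kernels whose two marginals are at most \<open>1\<close>. Integrating one
  coordinate at a time, Minkowski's integral inequality moves the remaining kernels out of the
  innermost norm and Jensen's inequality removes the kernel of the current coordinate; hence averages
  are contractions. The functions on which the averages converge along refinement of the
  families form a closed subspace. It contains the indicators of boxes, so by a Dynkin argument and
  dominated convergence it is everything. A contraction that is close to the identity on a finite net
  of a compact set is close to it on the whole set.
\<close>

section \<open>Real powers and norms of extended nonnegative functions\<close>

text \<open>With different exponents, one application of Jensen's inequality to a whole box gives no
  bound for the mixed norm, and the order of the integrals cannot be changed. Boxes are used because
  their kernel factors over the coordinates, so that each factor can be dealt with when its own
  coordinate is integrated. The marginals are at most 1, and not equal to 1, because finitely many
  sets of finite measure need not cover the space and cells of measure zero get coefficient 0.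

  The space may be nonseparable, and then no sequence of finite rank operators tends pointwise to
  the identity. Hence averages are indexed by all finite sets of sides, ordered by inclusion;
  eventual statements along this net combine, so a single operator serves any finite number of
  functions. Contractivity is what makes the set of functions with convergent averages closed.

  Norm estimates are made for functions with values in \<open>ennreal\<close>, where no
  integrability has to be known beforehand; integrability over boxes, and with it additivity of
  averages, is deduced from them.\<close>

lemma ennreal_powr_0 [simp]: "ennreal_powr 0 r = 0"
  by (simp add: ennreal_powr_def)

lemma ennreal_powr_one_right [simp]: "ennreal_powr a 1 = a"
  by (cases a) (auto simp: ennreal_powr_def)

lemma ennreal_powr_top [simp]: "ennreal_powr top r = top"
  by (simp add: ennreal_powr_def)

lemma ennreal_powr_ennreal: "0 \<le> x \<Longrightarrow> ennreal_powr (ennreal x) r = ennreal (x powr r)"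
  by (simp add: ennreal_powr_def)

lemma ennreal_powr_eq_top_iff [simp]: "ennreal_powr a r = top \<longleftrightarrow> a = top"
  by (simp add: ennreal_powr_def)

lemma ennreal_powr_less_top_iff [simp]: "ennreal_powr a r < top \<longleftrightarrow> a < top"
  by (simp flip: less_top)

lemma ennreal_powr_eq_0_iff [simp]: "ennreal_powr a r = 0 \<longleftrightarrow> a = 0"
  by (cases a) (auto simp: ennreal_powr_def)

lemma ennreal_powr_powr:
  assumes "0 < r" "0 < s"
  shows "ennreal_powr (ennreal_powr a r) s = ennreal_powr a (r * s)"
  using assms by (cases a) (auto simp: ennreal_powr_ennreal powr_powr)

lemma ennreal_powr_inverse:
  assumes "0 < r"
  shows "ennreal_powr (ennreal_powr a r) (1 / r) = a" "ennreal_powr (ennreal_powr a (1 / r)) r = a"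
  using assms by (simp_all add: ennreal_powr_powr)

lemma ennreal_powr_mult:
  assumes "0 < r"
  shows "ennreal_powr (a * b) r = ennreal_powr a r * ennreal_powr b r"
proof (cases "a = top \<or> b = top")
  case True
  then show ?thesis by (cases "a = 0 \<or> b = 0") (auto simp: ennreal_mult_eq_top_iff ennreal_top_mult ennreal_mult_top)
next
  case False
  then obtain x y where "a = ennreal x" "b = ennreal y" "0 \<le> x" "0 \<le> y"
    by (metis ennreal_cases infinity_ennreal_def)
  then show ?thesis
    by (simp add: ennreal_powr_ennreal powr_mult flip: ennreal_mult)
qed

lemma ennreal_powr_mono:
  assumes "0 < r" "a \<le> b"
  shows "ennreal_powr a r \<le> ennreal_powr b r"
proof (cases "b = top")
  case False
  then obtain x y where "a = ennreal x" "b = ennreal y" "0 \<le> x" "0 \<le> y"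
    using assms by (metis ennreal_cases infinity_ennreal_def neq_top_trans)
  with assms show ?thesis
    by (simp add: ennreal_powr_ennreal powr_mono2)
qed simp

lemma ennreal_powr_less_iff:
  assumes "0 < r"
  shows "ennreal_powr a r < ennreal_powr b r \<longleftrightarrow> a < b"
  using assms ennreal_powr_inverse(1)[OF assms] ennreal_powr_mono[OF assms]
  by (metis antisym_conv3 leD order_le_less)

lemma measurable_ennreal_powr [measurable (raw)]:
  assumes [measurable]: "f \<in> borel_measurable M"
  shows "(\<lambda>x. ennreal_powr (f x) r) \<in> borel_measurable M"
  unfolding ennreal_powr_def by measurable

lemma tendsto_ennreal_powr_0:
  assumes "0 < r" "(f \<longlongrightarrow> 0) F"
  shows "((\<lambda>x. ennreal_powr (f x) r) \<longlongrightarrow> 0) F"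
proof (rule order_tendstoI)
  fix y :: ennreal assume "0 < y"
  then have "0 < ennreal_powr y (1 / r)"
    by (simp add: zero_less_iff_neq_zero)
  then have "eventually (\<lambda>x. f x < ennreal_powr y (1 / r)) F"
    using assms(2) by (auto intro: order_tendstoD)
  then show "eventually (\<lambda>x. ennreal_powr (f x) r < y) F"
  proof eventually_elim
    case (elim x)
    then have "ennreal_powr (f x) r < ennreal_powr (ennreal_powr y (1 / r)) r"
      using assms(1) by (simp only: ennreal_powr_less_iff)
    then show ?case using assms(1) by (simp only: ennreal_powr_inverse)
  qed
qed auto

section \<open>Jensen's and Minkowski's integral inequalities\<close>

lemma powr_tangent_le:
  fixes x u q :: real
  assumes "1 \<le> q" "0 \<le> x" "0 < u"
  shows "q * u powr (q - 1) * x \<le> x powr q + (q - 1) * u powr q"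
proof (cases "x = 0")
  case False
  \<comment> \<open>The graph of the \<open>q\<close>-th power lies above its tangent at
    \<open>u\<close>. This is the weighted mean inequality with weights \<open>1 / q\<close> and
    \<open>1 - 1 / q\<close> for \<open>x powr q\<close> and \<open>u powr q\<close>, a form that
    includes \<open>q = 1\<close>.\<close>
  have "x * u powr (q - 1) = (x powr q) powr (1 / q) * (u powr q) powr (1 - 1 / q)"
    using assms False by (simp add: powr_powr algebra_simps)
  also have "\<dots> \<le> 1 / q * x powr q + (1 - 1 / q) * u powr q"
    using assms False by (intro Youngs_inequality_0) (auto simp: field_simps)
  finally have "q * (x * u powr (q - 1)) \<le> q * (1 / q * x powr q + (1 - 1 / q) * u powr q)"
    using assms by (intro mult_left_mono) auto
  also have "\<dots> = x powr q + (q - 1) * u powr q"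
    using assms by (simp add: field_simps)
  finally show ?thesis by (simp add: mult_ac)
qed (use assms in auto)

text \<open>Serves the infinite case of Jensen's inequality, where there is no finite point of
  tangency: an infinite mean forces an infinite mean of \<open>q\<close>-th powers.\<close>

lemma le_one_add_ennreal_powr:
  assumes "1 \<le> q"
  shows "h \<le> 1 + ennreal_powr h q"
proof (cases h)
  case (real r)
  have "r \<le> 1 + r powr q"
  proof (cases "r \<le> 1")
    case False
    then have "r powr 1 \<le> r powr q" using assms by (intro powr_mono) auto
    then show ?thesis using False by simp
  qed (auto intro: add_increasing2)
  then have "ennreal r \<le> ennreal (1 + r powr q)" by (rule ennreal_leI)
  then show ?thesis using real by (simp add: ennreal_powr_ennreal ennreal_plus)
qed simp

text \<open>The tangent inequality at the mean \<open>u\<close> itself is integrated against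
  \<open>w\<close>. The constant term of the tangent has the factor \<open>q - 1 \<ge> 0\<close>, so
  a mass of \<open>w\<close> below 1 only helps; averaging kernels do have smaller mass off their
  cells.\<close>

lemma ennreal_Jensen_powr:
  assumes q: "1 \<le> q" and [measurable]: "h \<in> borel_measurable M" "w \<in> borel_measurable M"
    and w: "(\<integral>\<^sup>+t. w t \<partial>M) \<le> 1"
  shows "ennreal_powr (\<integral>\<^sup>+t. h t * w t \<partial>M) q \<le> (\<integral>\<^sup>+t. ennreal_powr (h t) q * w t \<partial>M)"
proof -
  define u where "u = (\<integral>\<^sup>+t. h t * w t \<partial>M)"
  define I where "I = (\<integral>\<^sup>+t. ennreal_powr (h t) q * w t \<partial>M)"
  consider "u = 0" | "u = top" | r where "u = ennreal r" "0 < r"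
    by (cases u) (auto simp: less_le)
  then have "ennreal_powr u q \<le> I"
  proof cases
    case 2
    have "u \<le> (\<integral>\<^sup>+t. w t + ennreal_powr (h t) q * w t \<partial>M)"
      unfolding u_def using mult_right_mono[OF le_one_add_ennreal_powr[OF q]]
      by (intro nn_integral_mono) (simp add: distrib_right)
    also have "\<dots> = (\<integral>\<^sup>+t. w t \<partial>M) + I"
      unfolding I_def by (rule nn_integral_add) auto
    also have "\<dots> \<le> 1 + I" using w by (rule add_right_mono)
    finally have "I = top" using 2 by (simp add: top_unique)
    then show ?thesis by simp
  next
    case (3 r)
    have young: "ennreal (q * r powr (q - 1)) * a \<le> ennreal_powr a q + ennreal ((q - 1) * r powr q)" for a
    proof (cases a)
      case (real x)
      have "ennreal (q * r powr (q - 1) * x) \<le> ennreal (x powr q + (q - 1) * r powr q)"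
        using q real 3 by (intro ennreal_leI powr_tangent_le) auto
      then show ?thesis using real q by (simp add: ennreal_powr_ennreal ennreal_plus ennreal_mult)
    qed simp
    have "ennreal (q * r powr (q - 1)) * u = (\<integral>\<^sup>+t. (ennreal (q * r powr (q - 1)) * h t) * w t \<partial>M)"
      unfolding u_def by (subst nn_integral_cmult[symmetric]) (auto simp: mult.assoc)
    also have "\<dots> \<le> (\<integral>\<^sup>+t. ennreal_powr (h t) q * w t + ennreal ((q - 1) * r powr q) * w t \<partial>M)"
      using mult_right_mono[OF young] by (intro nn_integral_mono) (simp add: distrib_right)
    also have "\<dots> = I + ennreal ((q - 1) * r powr q) * (\<integral>\<^sup>+t. w t \<partial>M)"
      unfolding I_def by (simp add: nn_integral_add nn_integral_cmult)
    also have "\<dots> \<le> I + ennreal ((q - 1) * r powr q)"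
      using mult_left_mono[OF w, of "ennreal ((q - 1) * r powr q)"] by (intro add_left_mono) simp
    finally have *: "ennreal (q * r powr (q - 1) * r) \<le> I + ennreal ((q - 1) * r powr q)"
      using 3 q by (simp add: ennreal_mult)
    have "r powr (q - 1) * r = r powr q"
      using powr_add[of r "q - 1" 1] 3 by simp
    then have "q * r powr (q - 1) * r = r powr q + (q - 1) * r powr q"
      by (simp add: algebra_simps)
    with * have "ennreal (r powr q) + ennreal ((q - 1) * r powr q) \<le> I + ennreal ((q - 1) * r powr q)"
      using q by (simp add: ennreal_plus)
    then have "ennreal (r powr q) \<le> I"
      by (simp add: add.commute[of _ "ennreal ((q - 1) * r powr q)"] ennreal_add_left_cancel_le)
    then show ?thesis using 3 by (simp add: ennreal_powr_ennreal)
  qed simp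
  then show ?thesis by (simp add: u_def I_def)
qed

definition lp_norm :: "real \<Rightarrow> 'a measure \<Rightarrow> ('a \<Rightarrow> ennreal) \<Rightarrow> ennreal" where
  "lp_norm q M h = ennreal_powr (\<integral>\<^sup>+t. ennreal_powr (h t) q \<partial>M) (1 / q)"

lemma lp_norm_mono_AE:
  assumes "0 < q" "AE t in M. f t \<le> g t"
  shows "lp_norm q M f \<le> lp_norm q M g"
  unfolding lp_norm_def using assms
  by (intro ennreal_powr_mono nn_integral_mono_AE) (auto elim!: eventually_mono intro: ennreal_powr_mono)

lemma lp_norm_mono:
  assumes "0 < q" "\<And>t. t \<in> space M \<Longrightarrow> f t \<le> g t"
  shows "lp_norm q M f \<le> lp_norm q M g"
  using assms by (intro lp_norm_mono_AE) auto

lemma lp_norm_cong: "(\<And>t. t \<in> space M \<Longrightarrow> f t = g t) \<Longrightarrow> lp_norm q M f = lp_norm q M g"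
  unfolding lp_norm_def by (simp cong: nn_integral_cong)

lemma lp_norm_cmult:
  assumes "0 < q" "f \<in> borel_measurable M"
  shows "lp_norm q M (\<lambda>t. c * f t) = c * lp_norm q M f"
  using assms by (simp add: lp_norm_def ennreal_powr_mult nn_integral_cmult ennreal_powr_inverse)

lemma lp_norm_eq_0_iff:
  assumes "f \<in> borel_measurable M"
  shows "lp_norm q M f = 0 \<longleftrightarrow> (AE t in M. f t = 0)"
  using assms by (simp add: lp_norm_def nn_integral_0_iff_AE)

lemma lp_norm_less_top_AE:
  assumes "f \<in> borel_measurable M" "lp_norm q M f < top"
  shows "AE t in M. f t < top"
  using assms nn_integral_PInf_AE[of "\<lambda>t. ennreal_powr (f t) q" M]
  by (simp add: lp_norm_def less_top)

lemma lp_norm_tendsto_0: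
  assumes q: "0 < q" and [measurable]: "\<And>m. g m \<in> borel_measurable M" "h \<in> borel_measurable M"
    and bound: "\<And>m t. t \<in> space M \<Longrightarrow> g m t \<le> h t"
    and fin: "lp_norm q M h < top" and lim: "AE t in M. (\<lambda>m. g m t) \<longlonglongrightarrow> 0"
  shows "(\<lambda>m. lp_norm q M (g m)) \<longlonglongrightarrow> 0"
proof -
  have "(\<lambda>m. \<integral>\<^sup>+t. ennreal_powr (g m t) q \<partial>M) \<longlonglongrightarrow> (\<integral>\<^sup>+t. 0 \<partial>M)"
  proof (rule nn_integral_dominated_convergence)
    show "AE t in M. ennreal_powr (g m t) q \<le> ennreal_powr (h t) q" for m
      using bound q by (auto intro: ennreal_powr_mono)
    show "AE t in M. (\<lambda>m. ennreal_powr (g m t) q) \<longlonglongrightarrow> 0"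
      using lim by eventually_elim (rule tendsto_ennreal_powr_0[OF q])
  qed (use fin in \<open>auto simp: lp_norm_def\<close>)
  then show ?thesis
    unfolding lp_norm_def using q by (intro tendsto_ennreal_powr_0) auto
qed

text \<open>Instead of duality, the inner integral is written as a mean: \<open>b t / c\<close> has
  total mass 1, where \<open>b t\<close> slightly exceeds the norm of the slice \<open>h t\<close>
  and \<open>c\<close> is the integral of \<open>b\<close>. Jensen's inequality and Tonelli's
  theorem then bound the norm by \<open>c\<close>, and the excess tends to 0.\<close>

lemma lp_norm_Minkowski_integral:
  assumes q: "1 \<le> q" and "sigma_finite_measure M" "sigma_finite_measure N"
    and [measurable]: "(\<lambda>(t, s). h t s) \<in> borel_measurable (N \<Otimes>\<^sub>M M)"
  shows "lp_norm q M (\<lambda>s. \<integral>\<^sup>+t. h t s \<partial>N) \<le> (\<integral>\<^sup>+t. lp_norm q M (h t) \<partial>N)"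
proof -
  interpret M: sigma_finite_measure M by fact
  interpret N: sigma_finite_measure N by fact
  interpret NM: pair_sigma_finite N M ..
  have [measurable]: "(\<lambda>(s, t). h t s) \<in> borel_measurable (M \<Otimes>\<^sub>M N)"
    using measurable_pair_swap[OF assms(4)] by (simp add: case_prod_beta)
  define a where "a t = lp_norm q M (h t)" for t
  have [measurable]: "a \<in> borel_measurable N"
    unfolding a_def lp_norm_def by measurable
  define u where "u = (\<lambda>s. \<integral>\<^sup>+t. h t s \<partial>N)"
  have [measurable]: "u \<in> borel_measurable M"
    unfolding u_def by measurable
  \<comment> \<open>The norm \<open>a t\<close> may vanish but has to be divided by. Adding a small
    multiple of a positive function of finite integral, which \<sigma>-finiteness supplies, makes it
    positive at small cost.\<close>
  obtain e where [measurable]: "e \<in> borel_measurable N" and e_fin: "(\<integral>\<^sup>+t. e t \<partial>N) \<noteq> top"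
    and e: "\<And>t. t \<in> space N \<Longrightarrow> 0 < e t \<and> e t < top"
    using N.Ex_finite_integrable_function by (auto simp: infinity_ennreal_def)
  have key: "lp_norm q M u \<le> (\<integral>\<^sup>+t. a t \<partial>N) + ennreal \<delta> * (\<integral>\<^sup>+t. e t \<partial>N)"
    if fin: "(\<integral>\<^sup>+t. a t \<partial>N) \<noteq> top" and "0 < \<delta>" for \<delta> :: real
  proof -
    define b where "b t = a t + ennreal \<delta> * e t" for t
    define c where "c = (\<integral>\<^sup>+t. b t \<partial>N)"
    have [measurable]: "b \<in> borel_measurable N" unfolding b_def by measurable
    have c: "c = (\<integral>\<^sup>+t. a t \<partial>N) + ennreal \<delta> * (\<integral>\<^sup>+t. e t \<partial>N)"
      unfolding c_def b_def by (simp add: nn_integral_add nn_integral_cmult)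
    have "c \<noteq> top" using fin e_fin by (simp add: c ennreal_mult_eq_top_iff)
    have b_pos: "b t \<noteq> 0" "a t \<le> b t" if "t \<in> space N" for t
      using e[OF that] \<open>0 < \<delta>\<close> by (auto simp: b_def)
    have b_fin: "AE t in N. b t \<noteq> top"
      using nn_integral_PInf_AE[of b N] \<open>c \<noteq> top\<close> by (simp add: c_def)
    have "lp_norm q M u \<le> c"
    proof (cases "c = 0")
      \<comment> \<open>Since \<open>b\<close> is positive everywhere, its integral vanishes only if
        \<open>N\<close> is the zero measure.\<close>
      case True
      then have "AE t in N. b t = 0" unfolding c_def by (simp add: nn_integral_0_iff_AE)
      then have "AE t in N. False" using b_pos by (auto elim: AE_mp)
      then have "u s = (\<integral>\<^sup>+t. 0 \<partial>N)" for s
        unfolding u_def by (intro nn_integral_cong_AE) auto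
      then show ?thesis using q by (simp add: lp_norm_def)
    next
      case False
      have inv: "b t / c * (c / b t) = 1" if "b t \<noteq> 0" "b t \<noteq> top" for t
      proof -
        have "b t / c * (c / b t) = (b t / b t) * (c / c)" by (simp add: divide_ennreal_def mult_ac)
        then show ?thesis using that False \<open>c \<noteq> top\<close> by (simp add: top.not_eq_extremum)
      qed
      have pt: "ennreal_powr (u s) q \<le> (\<integral>\<^sup>+t. ennreal_powr (h t s * (c / b t)) q * (b t / c) \<partial>N)"
        if "s \<in> space M" for s
      proof -
        have [measurable]: "(\<lambda>t. h t s) \<in> borel_measurable N" using that by measurable
        have "u s = (\<integral>\<^sup>+t. h t s * (c / b t) * (b t / c) \<partial>N)"
          unfolding u_def
        proof (rule nn_integral_cong_AE)
          show "AE t in N. h t s = h t s * (c / b t) * (b t / c)"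
            using b_fin AE_space
            by eventually_elim (metis b_pos(1) inv mult.assoc mult.commute mult.right_neutral)
        qed
        also have "ennreal_powr \<dots> q \<le> (\<integral>\<^sup>+t. ennreal_powr (h t s * (c / b t)) q * (b t / c) \<partial>N)"
          using False \<open>c \<noteq> top\<close>
          by (intro ennreal_Jensen_powr q) (auto simp: nn_integral_divide less_top c_def[symmetric])
        finally show ?thesis .
      qed
      have "(\<integral>\<^sup>+s. ennreal_powr (u s) q \<partial>M)
          \<le> (\<integral>\<^sup>+s. (\<integral>\<^sup>+t. ennreal_powr (h t s * (c / b t)) q * (b t / c) \<partial>N) \<partial>M)"
        by (intro nn_integral_mono pt)
      also have "\<dots> = (\<integral>\<^sup>+t. (\<integral>\<^sup>+s. ennreal_powr (h t s * (c / b t)) q * (b t / c) \<partial>M) \<partial>N)"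
        by (rule NM.Fubini') measurable
      also have "\<dots> \<le> (\<integral>\<^sup>+t. ennreal_powr c q * (b t / c) \<partial>N)"
      proof (rule nn_integral_mono_AE)
        show "AE t in N. (\<integral>\<^sup>+s. ennreal_powr (h t s * (c / b t)) q * (b t / c) \<partial>M) \<le> ennreal_powr c q * (b t / c)"
          using b_fin AE_space
        proof eventually_elim
          case (elim t)
          have [measurable]: "h t \<in> borel_measurable M" using elim by measurable
          have "(\<integral>\<^sup>+s. ennreal_powr (h t s * (c / b t)) q * (b t / c) \<partial>M)
              = ennreal_powr (a t) q * ennreal_powr (c / b t) q * (b t / c)"
            using q by (simp add: ennreal_powr_mult nn_integral_multc a_def lp_norm_def ennreal_powr_inverse)
          also have "\<dots> = ennreal_powr (a t * (c / b t)) q * (b t / c)"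
            using q by (simp add: ennreal_powr_mult)
          also have "\<dots> \<le> ennreal_powr c q * (b t / c)"
          proof (intro mult_right_mono ennreal_powr_mono)
            have "a t * (c / b t) \<le> b t * (c / b t)"
              using b_pos(2)[OF elim(2)] by (intro mult_right_mono) auto
            also have "\<dots> = c"
              using elim b_pos(1) by (simp add: ennreal_times_divide mult.commute[of _ c] less_top ennreal_mult_divide_eq mult_divide_eq_ennreal)
            finally show "a t * (c / b t) \<le> c" .
          qed (use q in auto)
          finally show ?case .
        qed
      qed
      also have "\<dots> = ennreal_powr c q"
        using False \<open>c \<noteq> top\<close> by (simp add: nn_integral_cmult nn_integral_divide c_def[symmetric] less_top)
      finally have "lp_norm q M u \<le> ennreal_powr (ennreal_powr c q) (1 / q)"
        unfolding lp_norm_def using q by (intro ennreal_powr_mono) auto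
      then show ?thesis using q by (simp add: ennreal_powr_inverse)
    qed
    then show ?thesis by (simp add: c)
  qed
  have "lp_norm q M u \<le> (\<integral>\<^sup>+t. a t \<partial>N)"
  proof (cases "(\<integral>\<^sup>+t. a t \<partial>N) = top")
    case False
    obtain r where r: "0 \<le> r" "(\<integral>\<^sup>+t. e t \<partial>N) = ennreal r"
      using e_fin by (cases "\<integral>\<^sup>+t. e t \<partial>N") auto
    show ?thesis
    proof (rule ennreal_le_epsilon)
      fix \<epsilon> :: real assume "0 < \<epsilon>"
      \<comment> \<open>Dividing by \<open>1 + r\<close> instead of \<open>r\<close> also covers
        \<open>r = 0\<close>, and \<open>r / (1 + r) \<le> 1\<close>.\<close>
      have "lp_norm q M u \<le> (\<integral>\<^sup>+t. a t \<partial>N) + ennreal (\<epsilon> / (1 + r)) * ennreal r"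
        using key[OF False, of "\<epsilon> / (1 + r)"] r \<open>0 < \<epsilon>\<close> by simp
      also have "\<dots> \<le> (\<integral>\<^sup>+t. a t \<partial>N) + ennreal \<epsilon>"
        using r \<open>0 < \<epsilon>\<close> by (auto simp: ennreal_mult[symmetric] field_simps intro!: add_left_mono ennreal_leI)
      finally show "lp_norm q M u \<le> (\<integral>\<^sup>+t. a t \<partial>N) + ennreal \<epsilon>" .
    qed
  qed simp
  then show ?thesis by (simp add: u_def a_def)
qed

text \<open>The integral inequality over the counting measure on two points.\<close>

lemma lp_norm_add_le:
  assumes "1 \<le> q" "sigma_finite_measure M" and [measurable]: "f \<in> borel_measurable M" "g \<in> borel_measurable M"
  shows "lp_norm q M (\<lambda>t. f t + g t) \<le> lp_norm q M f + lp_norm q M g"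
proof -
  let ?N = "count_space (UNIV :: bool set)"
  have "lp_norm q M (\<lambda>s. \<integral>\<^sup>+t. (if t then f s else g s) \<partial>?N) \<le> (\<integral>\<^sup>+t. lp_norm q M (\<lambda>s. if t then f s else g s) \<partial>?N)"
    by (intro lp_norm_Minkowski_integral assms sigma_finite_measure_count_space) measurable
  then show ?thesis by (simp add: nn_integral_count_space_finite UNIV_bool add.commute)
qed

text \<open>The Schur test with both constants 1. The bound on the integrals over \<open>t\<close>
  permits Jensen's inequality; after Tonelli the bound on the integrals over \<open>s\<close>
  absorbs the kernel.\<close>

lemma lp_norm_kernel_le:
  assumes q: "1 \<le> q" and "sigma_finite_measure M"
    and [measurable]: "(\<lambda>(s, t). k s t) \<in> borel_measurable (M \<Otimes>\<^sub>M M)" "h \<in> borel_measurable M"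
    and k1: "\<And>s. s \<in> space M \<Longrightarrow> (\<integral>\<^sup>+t. k s t \<partial>M) \<le> 1"
    and k2: "\<And>t. t \<in> space M \<Longrightarrow> (\<integral>\<^sup>+s. k s t \<partial>M) \<le> 1"
  shows "lp_norm q M (\<lambda>s. \<integral>\<^sup>+t. h t * k s t \<partial>M) \<le> lp_norm q M h"
proof -
  interpret M: sigma_finite_measure M by fact
  interpret MM: pair_sigma_finite M M ..
  have "(\<integral>\<^sup>+s. ennreal_powr (\<integral>\<^sup>+t. h t * k s t \<partial>M) q \<partial>M)
      \<le> (\<integral>\<^sup>+s. (\<integral>\<^sup>+t. ennreal_powr (h t) q * k s t \<partial>M) \<partial>M)"
    by (intro nn_integral_mono ennreal_Jensen_powr q k1) measurable
  also have "\<dots> = (\<integral>\<^sup>+t. (\<integral>\<^sup>+s. ennreal_powr (h t) q * k s t \<partial>M) \<partial>M)"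
    by (rule MM.Fubini'[symmetric]) measurable
  also have "\<dots> = (\<integral>\<^sup>+t. ennreal_powr (h t) q * (\<integral>\<^sup>+s. k s t \<partial>M) \<partial>M)"
    by (intro nn_integral_cong nn_integral_cmult) measurable
  also have "\<dots> \<le> (\<integral>\<^sup>+t. ennreal_powr (h t) q * 1 \<partial>M)"
    by (intro nn_integral_mono mult_left_mono k2) auto
  finally show ?thesis
    unfolding lp_norm_def using q by (intro ennreal_powr_mono) auto
qed

section \<open>Iterated norms\<close>

text \<open>The ratio of consecutive exponents in \<open>mixed_integral\<close> is the root of one
  level merged with the power of the next. With the root taken at each level, every step is an
  ordinary norm in one variable, so homogeneity and Minkowski's inequality apply to it.\<close>

primrec iterated_norm ::
    "(nat \<Rightarrow> 'a measure) \<Rightarrow> (nat \<Rightarrow> real) \<Rightarrow> ((nat \<Rightarrow> 'a) \<Rightarrow> ennreal) \<Rightarrow> nat \<Rightarrow> (nat \<Rightarrow> 'a) \<Rightarrow> ennreal" where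
  "iterated_norm M p g 0 = g"
| "iterated_norm M p g (Suc k) = (\<lambda>x. lp_norm (p (Suc k)) (M (Suc k)) (\<lambda>t. iterated_norm M p g k (x(Suc k := t))))"

locale mixed_exponents = product_sigma_finite M
  for M :: "nat \<Rightarrow> 'a measure" +
  fixes n :: nat and p :: "nat \<Rightarrow> real"
  assumes p_ge_1: "\<And>i. i \<in> {1..n} \<Longrightarrow> 1 \<le> p i"
begin

abbreviation tail_space :: "nat \<Rightarrow> (nat \<Rightarrow> 'a) measure" where
  "tail_space k \<equiv> Pi\<^sub>M {Suc k..n} M"

abbreviation N :: "nat \<Rightarrow> ((nat \<Rightarrow> 'a) \<Rightarrow> ennreal) \<Rightarrow> (nat \<Rightarrow> 'a) \<Rightarrow> ennreal" where
  "N k g \<equiv> iterated_norm M p g k"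

lemma p_Suc: "k < n \<Longrightarrow> 1 \<le> p (Suc k)"
  using p_ge_1[of "Suc k"] by simp

lemma p_Suc_pos: "k < n \<Longrightarrow> 0 < p (Suc k)"
  using p_Suc[of k] by simp

lemma insert_tail: "k < n \<Longrightarrow> insert (Suc k) {Suc (Suc k)..n} = {Suc k..n}"
  by auto

lemma measurable_update_tail [measurable]:
  "k < n \<Longrightarrow> (\<lambda>(x, t). x(Suc k := t)) \<in> measurable (tail_space (Suc k) \<Otimes>\<^sub>M M (Suc k)) (tail_space k)"
  using measurable_add_dim[of "Suc k" "{Suc (Suc k)..n}" M] by (simp add: insert_tail)

lemma measurable_update_slice:
  assumes "k < n" "x \<in> space (tail_space (Suc k))"
  shows "(\<lambda>t. x(Suc k := t)) \<in> measurable (M (Suc k)) (tail_space k)"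
  using measurable_component_update[OF assms(2), of "Suc k"] assms(1) by (simp add: insert_tail)

lemma update_in_tail:
  assumes "k < n" "x \<in> space (tail_space (Suc k))" "t \<in> space (M (Suc k))"
  shows "x(Suc k := t) \<in> space (tail_space k)"
  using measurable_space[OF measurable_update_slice[OF assms(1,2)] assms(3)] .

lemma slice_measurable:
  assumes "k < n" "x \<in> space (tail_space (Suc k))" "g \<in> borel_measurable (tail_space k)"
  shows "(\<lambda>t. g (x(Suc k := t))) \<in> borel_measurable (M (Suc k))"
  using measurable_compose[OF measurable_update_slice[OF assms(1,2)] assms(3)] .

lemma pair_slice_measurable:
  assumes "k < n" "g \<in> borel_measurable (tail_space k)"
  shows "(\<lambda>(x, t). g (x(Suc k := t))) \<in> borel_measurable (tail_space (Suc k) \<Otimes>\<^sub>M M (Suc k))"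
  using measurable_compose[OF measurable_update_tail[OF assms(1)] assms(2)] by (simp add: case_prod_beta)

lemma nn_integral_tail:
  assumes "k < n" "g \<in> borel_measurable (tail_space k)"
  shows "(\<integral>\<^sup>+z. g z \<partial>tail_space k) = (\<integral>\<^sup>+x. (\<integral>\<^sup>+t. g (x(Suc k := t)) \<partial>M (Suc k)) \<partial>tail_space (Suc k))"
  using product_nn_integral_insert[of "{Suc (Suc k)..n}" "Suc k" g] assms by (simp add: insert_tail)

lemma measurable_iterated_norm:
  assumes "g \<in> borel_measurable (tail_space 0)" "k \<le> n"
  shows "N k g \<in> borel_measurable (tail_space k)"
  using assms(2)
proof (induction k)
  case (Suc k)
  interpret sigma_finite_measure "M (Suc k)" by (rule sigma_finite_measures)
  have [measurable]: "(\<lambda>(x, t). N k g (x(Suc k := t))) \<in> borel_measurable (tail_space (Suc k) \<Otimes>\<^sub>M M (Suc k))"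
    using Suc by (intro pair_slice_measurable) auto
  show ?case by (simp add: lp_norm_def)
qed (use assms in simp)

lemma iterated_norm_mono:
  assumes "\<And>x. x \<in> space (tail_space 0) \<Longrightarrow> f x \<le> g x"
  shows "k \<le> n \<Longrightarrow> x \<in> space (tail_space k) \<Longrightarrow> N k f x \<le> N k g x"
proof (induction k arbitrary: x)
  case (Suc k)
  then show ?case
    unfolding iterated_norm.simps by (intro lp_norm_mono p_Suc_pos Suc.IH update_in_tail) auto
qed (use assms in simp)

lemma iterated_norm_cmult:
  assumes "g \<in> borel_measurable (tail_space 0)"
  shows "k \<le> n \<Longrightarrow> x \<in> space (tail_space k) \<Longrightarrow> N k (\<lambda>x. c * g x) x = c * N k g x"
proof (induction k arbitrary: x)
  case (Suc k)
  have "N (Suc k) (\<lambda>x. c * g x) x = lp_norm (p (Suc k)) (M (Suc k)) (\<lambda>t. c * N k g (x(Suc k := t)))"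
    unfolding iterated_norm.simps using Suc.prems by (intro lp_norm_cong Suc.IH update_in_tail) auto
  also have "\<dots> = c * N (Suc k) g x"
    using Suc.prems assms by (simp add: lp_norm_cmult p_Suc_pos slice_measurable measurable_iterated_norm)
  finally show ?case .
qed simp

lemma iterated_norm_add_le:
  assumes "f \<in> borel_measurable (tail_space 0)" "g \<in> borel_measurable (tail_space 0)"
  shows "k \<le> n \<Longrightarrow> x \<in> space (tail_space k) \<Longrightarrow> N k (\<lambda>x. f x + g x) x \<le> N k f x + N k g x"
proof (induction k arbitrary: x)
  case (Suc k)
  have "N (Suc k) (\<lambda>x. f x + g x) x
      \<le> lp_norm (p (Suc k)) (M (Suc k)) (\<lambda>t. N k f (x(Suc k := t)) + N k g (x(Suc k := t)))"
    unfolding iterated_norm.simps using Suc.prems by (intro lp_norm_mono p_Suc_pos Suc.IH update_in_tail) auto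
  also have "\<dots> \<le> N (Suc k) f x + N (Suc k) g x"
    using Suc.prems assms
    by (simp add: lp_norm_add_le p_Suc slice_measurable measurable_iterated_norm sigma_finite_measures)
  finally show ?case .
qed simp

text \<open>A nonnegative measurable function vanishes almost everywhere exactly if its integral is
  0; this is used for the product and for the slices, with Tonelli between them.\<close>

lemma AE_tail_iff:
  assumes "k < n" "g \<in> borel_measurable (tail_space k)"
  shows "(AE z in tail_space k. g z = (0::ennreal)) \<longleftrightarrow>
    (AE x in tail_space (Suc k). AE t in M (Suc k). g (x(Suc k := t)) = 0)"
proof -
  interpret sigma_finite_measure "M (Suc k)" by (rule sigma_finite_measures)
  note [measurable] = pair_slice_measurable[OF assms]
  have "(AE z in tail_space k. g z = 0) \<longleftrightarrow>
      (AE x in tail_space (Suc k). (\<integral>\<^sup>+t. g (x(Suc k := t)) \<partial>M (Suc k)) = 0)"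
    using assms nn_integral_tail[OF assms] by (simp flip: nn_integral_0_iff_AE)
  also have "\<dots> \<longleftrightarrow> (AE x in tail_space (Suc k). AE t in M (Suc k). g (x(Suc k := t)) = 0)"
    using assms by (intro AE_cong) (simp add: nn_integral_0_iff_AE slice_measurable)
  finally show ?thesis .
qed

lemma iterated_norm_AE_eq_0_iff:
  assumes "g \<in> borel_measurable (tail_space 0)"
  shows "k \<le> n \<Longrightarrow> (AE x in tail_space k. N k g x = 0) \<longleftrightarrow> (AE x in tail_space 0. g x = 0)"
proof (induction k)
  case (Suc k)
  have "(AE x in tail_space (Suc k). N (Suc k) g x = 0) \<longleftrightarrow>
      (AE x in tail_space (Suc k). AE t in M (Suc k). N k g (x(Suc k := t)) = 0)"
    using Suc.prems assms
    by (intro AE_cong) (simp add: lp_norm_eq_0_iff slice_measurable measurable_iterated_norm)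
  also have "\<dots> \<longleftrightarrow> (AE x in tail_space k. N k g x = 0)"
    using Suc.prems assms by (intro AE_tail_iff[symmetric] measurable_iterated_norm) auto
  finally show ?case using Suc by simp
qed simp

text \<open>Dominated convergence level by level. Finiteness of the norm of \<open>h\<close> at one
  level makes the norm at the level below finite only for almost every value of the coordinate, so
  the induction hypothesis is available only there, which is enough for
  \<open>lp_norm_tendsto_0\<close>.\<close>

lemma iterated_norm_tendsto_0:
  assumes "\<And>m. g m \<in> borel_measurable (tail_space 0)" "h \<in> borel_measurable (tail_space 0)"
    and "\<And>m x. x \<in> space (tail_space 0) \<Longrightarrow> g m x \<le> h x"
    and "\<And>x. x \<in> space (tail_space 0) \<Longrightarrow> (\<lambda>m. g m x) \<longlonglongrightarrow> 0"
  shows "k \<le> n \<Longrightarrow> x \<in> space (tail_space k) \<Longrightarrow> N k h x < top \<Longrightarrow> (\<lambda>m. N k (g m) x) \<longlonglongrightarrow> 0"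
proof (induction k arbitrary: x)
  case (Suc k)
  have "AE t in M (Suc k). N k h (x(Suc k := t)) < top"
    using Suc.prems assms(2)
    by (intro lp_norm_less_top_AE slice_measurable measurable_iterated_norm) auto
  then have "AE t in M (Suc k). (\<lambda>m. N k (g m) (x(Suc k := t))) \<longlonglongrightarrow> 0"
    using AE_space by eventually_elim (use Suc.prems in \<open>auto intro!: Suc.IH update_in_tail\<close>)
  then show ?case
    using Suc.prems assms(1-3)
    by (auto intro!: lp_norm_tendsto_0[where h = "\<lambda>t. N k h (x(Suc k := t))"] p_Suc_pos
        slice_measurable measurable_iterated_norm iterated_norm_mono update_in_tail)
qed (use assms in simp)

text \<open>The kernels of coordinates not yet reached stay outside the norm, as an integral over
  \<open>tail_space k\<close>. In the step, Minkowski's inequality moves the integral over the later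
  coordinates out of the norm in coordinate \<open>Suc k\<close>, and the Schur test removes
  \<open>\<kappa> (Suc k)\<close>. At \<open>k = n\<close> the product of kernels is empty.\<close>

lemma iterated_norm_kernel_le:
  fixes \<kappa> :: "nat \<Rightarrow> 'a \<Rightarrow> 'a \<Rightarrow> ennreal"
  assumes g: "g \<in> borel_measurable (tail_space 0)"
    and \<kappa>: "\<And>i. i \<in> {1..n} \<Longrightarrow> (\<lambda>(s, t). \<kappa> i s t) \<in> borel_measurable (M i \<Otimes>\<^sub>M M i)"
    and \<kappa>1: "\<And>i s. i \<in> {1..n} \<Longrightarrow> s \<in> space (M i) \<Longrightarrow> (\<integral>\<^sup>+t. \<kappa> i s t \<partial>M i) \<le> 1"
    and \<kappa>2: "\<And>i t. i \<in> {1..n} \<Longrightarrow> t \<in> space (M i) \<Longrightarrow> (\<integral>\<^sup>+s. \<kappa> i s t \<partial>M i) \<le> 1"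
  shows "k \<le> n \<Longrightarrow> x \<in> space (tail_space k) \<Longrightarrow>
    N k (\<lambda>x. \<integral>\<^sup>+y. g y * (\<Prod>i\<in>{1..n}. \<kappa> i (x i) (y i)) \<partial>tail_space 0) x
    \<le> (\<integral>\<^sup>+y. N k g y * (\<Prod>i\<in>{Suc k..n}. \<kappa> i (x i) (y i)) \<partial>tail_space k)"
proof (induction k arbitrary: x)
  case (Suc k)
  define G where "G = (\<lambda>x. \<integral>\<^sup>+y. g y * (\<Prod>i\<in>{1..n}. \<kappa> i (x i) (y i)) \<partial>tail_space 0)"
  have k: "k < n" and x: "x \<in> space (tail_space (Suc k))" using Suc.prems by auto
  interpret m: sigma_finite_measure "M (Suc k)" by (rule sigma_finite_measures)
  interpret sigma_finite_measure "tail_space (Suc k)" by (rule sigma_finite) simp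
  define K where "K y = (\<Prod>i\<in>{Suc (Suc k)..n}. \<kappa> i (x i) (y i))" for y
  have \<kappa>_slice: "\<kappa> i s \<in> borel_measurable (M i)" if "i \<in> {1..n}" "s \<in> space (M i)" for i s
    using measurable_Pair2[OF \<kappa>[OF that(1)] that(2)] by simp
  have \<kappa>_prod: "(\<lambda>y. \<Prod>i\<in>{Suc j..n}. \<kappa> i (z i) (y i)) \<in> borel_measurable (tail_space j)"
    if "z \<in> space (tail_space j)" for j z
  proof (rule borel_measurable_prod_ennreal)
    fix i assume "i \<in> {Suc j..n}"
    with that show "(\<lambda>y. \<kappa> i (z i) (y i)) \<in> borel_measurable (tail_space j)"
      by (intro measurable_compose[OF measurable_component_singleton, where g = "\<kappa> i (z i)"] \<kappa>_slice)
        (auto simp: space_PiM)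
  qed
  have [measurable]: "K \<in> borel_measurable (tail_space (Suc k))"
    unfolding K_def by (rule \<kappa>_prod[OF x])
  have [measurable]: "(\<lambda>(y, t). N k g (y(Suc k := t))) \<in> borel_measurable (tail_space (Suc k) \<Otimes>\<^sub>M M (Suc k))"
    using k g by (intro pair_slice_measurable measurable_iterated_norm) auto
  have [measurable]: "(\<lambda>(s, t). \<kappa> (Suc k) s t) \<in> borel_measurable (M (Suc k) \<Otimes>\<^sub>M M (Suc k))"
    using k by (intro \<kappa>) auto
  \<comment> \<open>Coordinate \<open>Suc k\<close> is isolated here: \<open>H\<close> contains its
    kernel, while \<open>K\<close> contains those of the later coordinates and does not depend on
    \<open>s\<close>, so it can leave the norm by homogeneity.\<close>
  define H where "H y s = (\<integral>\<^sup>+t. N k g (y(Suc k := t)) * \<kappa> (Suc k) s t \<partial>M (Suc k))" for y s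
  have [measurable]: "(\<lambda>(y, s). H y s) \<in> borel_measurable (tail_space (Suc k) \<Otimes>\<^sub>M M (Suc k))"
    unfolding H_def by measurable
  have step: "N k G (x(Suc k := s)) \<le> (\<integral>\<^sup>+y. K y * H y s \<partial>tail_space (Suc k))"
    if s: "s \<in> space (M (Suc k))" for s
  proof -
    have "N k G (x(Suc k := s))
        \<le> (\<integral>\<^sup>+z. N k g z * (\<Prod>i\<in>{Suc k..n}. \<kappa> i ((x(Suc k := s)) i) (z i)) \<partial>tail_space k)"
      unfolding G_def using k x s by (intro Suc.IH update_in_tail) auto
    also have "\<dots> = (\<integral>\<^sup>+y. (\<integral>\<^sup>+t. N k g (y(Suc k := t)) *
        (\<Prod>i\<in>{Suc k..n}. \<kappa> i ((x(Suc k := s)) i) ((y(Suc k := t)) i)) \<partial>M (Suc k)) \<partial>tail_space (Suc k))"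
      using k x s g
      by (intro nn_integral_tail borel_measurable_times_ennreal \<kappa>_prod update_in_tail measurable_iterated_norm) auto
    also have "\<dots> = (\<integral>\<^sup>+y. (\<integral>\<^sup>+t. K y * (N k g (y(Suc k := t)) * \<kappa> (Suc k) s t) \<partial>M (Suc k)) \<partial>tail_space (Suc k))"
    proof (intro nn_integral_cong)
      fix y t
      have "(\<Prod>i\<in>{Suc (Suc k)..n}. \<kappa> i ((x(Suc k := s)) i) ((y(Suc k := t)) i)) = K y"
        unfolding K_def by (rule prod.cong) auto
      then show "N k g (y(Suc k := t)) * (\<Prod>i\<in>{Suc k..n}. \<kappa> i ((x(Suc k := s)) i) ((y(Suc k := t)) i))
          = K y * (N k g (y(Suc k := t)) * \<kappa> (Suc k) s t)"
        using k by (subst insert_tail[OF k, symmetric], subst prod.insert) (simp_all add: mult_ac)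
    qed
    also have "\<dots> = (\<integral>\<^sup>+y. K y * H y s \<partial>tail_space (Suc k))"
      unfolding H_def
    proof (intro nn_integral_cong nn_integral_cmult)
      fix y assume [measurable]: "y \<in> space (tail_space (Suc k))"
      show "(\<lambda>t. N k g (y(Suc k := t)) * \<kappa> (Suc k) s t) \<in> borel_measurable (M (Suc k))"
        using s by measurable
    qed
    finally show ?thesis .
  qed
  have "N (Suc k) G x \<le> lp_norm (p (Suc k)) (M (Suc k)) (\<lambda>s. \<integral>\<^sup>+y. K y * H y s \<partial>tail_space (Suc k))"
    using k by (auto intro!: lp_norm_mono p_Suc_pos step)
  also have "\<dots> \<le> (\<integral>\<^sup>+y. lp_norm (p (Suc k)) (M (Suc k)) (\<lambda>s. K y * H y s) \<partial>tail_space (Suc k))"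
    using k by (intro lp_norm_Minkowski_integral p_Suc sigma_finite_measures sigma_finite_measure_axioms) measurable
  also have "\<dots> \<le> (\<integral>\<^sup>+y. N (Suc k) g y * K y \<partial>tail_space (Suc k))"
  proof (rule nn_integral_mono)
    fix y assume y: "y \<in> space (tail_space (Suc k))"
    then have [measurable]: "H y \<in> borel_measurable (M (Suc k))" by measurable
    have "lp_norm (p (Suc k)) (M (Suc k)) (\<lambda>s. K y * H y s) = K y * lp_norm (p (Suc k)) (M (Suc k)) (H y)"
      using k by (intro lp_norm_cmult p_Suc_pos) auto
    also have "\<dots> \<le> K y * N (Suc k) g y"
      unfolding H_def iterated_norm.simps using k y g
      by (intro mult_left_mono lp_norm_kernel_le p_Suc sigma_finite_measures slice_measurable
          measurable_iterated_norm \<kappa> \<kappa>1 \<kappa>2) auto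
    finally show "lp_norm (p (Suc k)) (M (Suc k)) (\<lambda>s. K y * H y s) \<le> N (Suc k) g y * K y"
      by (simp add: mult.commute)
  qed
  finally show ?case unfolding G_def K_def .
qed simp

section \<open>The norm in all coordinates\<close>

definition total_norm :: "((nat \<Rightarrow> 'a) \<Rightarrow> ennreal) \<Rightarrow> ennreal" where
  "total_norm g = N n g (\<lambda>_. undefined)"

abbreviation \<Omega> :: "(nat \<Rightarrow> 'a) measure" where
  "\<Omega> \<equiv> Pi\<^sub>M {1..n} M"

lemma undefined_in_tail: "(\<lambda>_. undefined) \<in> space (tail_space n)"
  by (simp add: space_PiM)

lemma total_norm_mono: "(\<And>x. x \<in> space \<Omega> \<Longrightarrow> f x \<le> g x) \<Longrightarrow> total_norm f \<le> total_norm g"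
  unfolding total_norm_def by (intro iterated_norm_mono undefined_in_tail) auto

lemma total_norm_cong: "(\<And>x. x \<in> space \<Omega> \<Longrightarrow> f x = g x) \<Longrightarrow> total_norm f = total_norm g"
  by (intro antisym total_norm_mono) auto

lemma total_norm_cmult: "g \<in> borel_measurable \<Omega> \<Longrightarrow> total_norm (\<lambda>x. c * g x) = c * total_norm g"
  unfolding total_norm_def by (intro iterated_norm_cmult undefined_in_tail) auto

lemma total_norm_add_le:
  "f \<in> borel_measurable \<Omega> \<Longrightarrow> g \<in> borel_measurable \<Omega> \<Longrightarrow>
    total_norm (\<lambda>x. f x + g x) \<le> total_norm f + total_norm g"
  unfolding total_norm_def by (intro iterated_norm_add_le undefined_in_tail) auto

lemma total_norm_eq_0_iff:
  assumes "g \<in> borel_measurable \<Omega>"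
  shows "total_norm g = 0 \<longleftrightarrow> (AE x in \<Omega>. g x = 0)"
proof -
  \<comment> \<open>With no coordinate left the product is a single point of mass 1, so an almost
    everywhere statement is a statement about that point.\<close>
  have "tail_space n = count_space {\<lambda>_. undefined}"
    by (simp add: PiM_empty)
  then have "total_norm g = 0 \<longleftrightarrow> (AE x in tail_space n. N n g x = 0)"
    by (simp only: total_norm_def AE_count_space) simp
  then show ?thesis
    using iterated_norm_AE_eq_0_iff[of g n] assms unfolding One_nat_def by blast
qed

lemma total_norm_tendsto_0:
  assumes "\<And>m. g m \<in> borel_measurable \<Omega>" "h \<in> borel_measurable \<Omega>"
    and "\<And>m x. x \<in> space \<Omega> \<Longrightarrow> g m x \<le> h x" "total_norm h < top"
    and "\<And>x. x \<in> space \<Omega> \<Longrightarrow> (\<lambda>m. g m x) \<longlonglongrightarrow> 0"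
  shows "(\<lambda>m. total_norm (g m)) \<longlonglongrightarrow> 0"
  unfolding total_norm_def using assms
  by (intro iterated_norm_tendsto_0[where h = h] undefined_in_tail) (auto simp: total_norm_def)

lemma total_norm_kernel_le:
  fixes \<kappa> :: "nat \<Rightarrow> 'a \<Rightarrow> 'a \<Rightarrow> ennreal"
  assumes "g \<in> borel_measurable \<Omega>"
    and "\<And>i. i \<in> {1..n} \<Longrightarrow> (\<lambda>(s, t). \<kappa> i s t) \<in> borel_measurable (M i \<Otimes>\<^sub>M M i)"
    and "\<And>i s. i \<in> {1..n} \<Longrightarrow> s \<in> space (M i) \<Longrightarrow> (\<integral>\<^sup>+t. \<kappa> i s t \<partial>M i) \<le> 1"
    and "\<And>i t. i \<in> {1..n} \<Longrightarrow> t \<in> space (M i) \<Longrightarrow> (\<integral>\<^sup>+s. \<kappa> i s t \<partial>M i) \<le> 1"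
  shows "total_norm (\<lambda>x. \<integral>\<^sup>+y. g y * (\<Prod>i\<in>{1..n}. \<kappa> i (x i) (y i)) \<partial>\<Omega>) \<le> total_norm g"
  using iterated_norm_kernel_le[of g \<kappa> n "\<lambda>_. undefined"] assms undefined_in_tail
  by (simp add: total_norm_def nn_integral_empty)

text \<open>Each level leaves at most a finite multiple of the indicator of the box in the remaining
  coordinates; the new factor is a root of the measure of one side.\<close>

lemma total_norm_box_less_top:
  assumes E: "\<And>i. i \<in> {1..n} \<Longrightarrow> E i \<in> sets (M i)" "\<And>i. i \<in> {1..n} \<Longrightarrow> emeasure (M i) (E i) < top"
  shows "total_norm (indicator (Pi\<^sub>E {1..n} E)) < top"
proof -
  have "\<exists>c<top. \<forall>x\<in>space (tail_space k). N k (indicator (Pi\<^sub>E {1..n} E)) x \<le> c * indicator (Pi\<^sub>E {Suc k..n} E) x"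
    if "k \<le> n" for k
    using that
  proof (induction k)
    case 0
    show ?case by (intro exI[of _ 1]) auto
  next
    case (Suc k)
    then obtain c where c: "c < top" and le: "\<And>x. x \<in> space (tail_space k) \<Longrightarrow>
        N k (indicator (Pi\<^sub>E {1..n} E)) x \<le> c * indicator (Pi\<^sub>E {Suc k..n} E) x"
      by auto
    have k: "k < n" using Suc by simp
    define e where "e = lp_norm (p (Suc k)) (M (Suc k)) (indicator (E (Suc k)))"
    have "ennreal_powr (indicator (E (Suc k)) t) (p (Suc k)) = indicator (E (Suc k)) t" for t
      using ennreal_powr_ennreal[of 1] by (auto simp: indicator_def)
    then have "e < top"
      using k E by (simp add: e_def lp_norm_def)
    show ?case
    proof (intro exI[of _ "c * e"] conjI ballI)
      show "c * e < top" using c \<open>e < top\<close> by (simp add: ennreal_mult_less_top)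
      fix x assume x: "x \<in> space (tail_space (Suc k))"
      have "N (Suc k) (indicator (Pi\<^sub>E {1..n} E)) x \<le>
        lp_norm (p (Suc k)) (M (Suc k)) (\<lambda>t. (c * indicator (Pi\<^sub>E {Suc (Suc k)..n} E) x) * indicator (E (Suc k)) t)"
        unfolding iterated_norm.simps
      proof (intro lp_norm_mono p_Suc_pos k order_trans[OF le])
        fix t assume t: "t \<in> space (M (Suc k))"
        show "x(Suc k := t) \<in> space (tail_space k)" using k x t by (rule update_in_tail)
        have "x(Suc k := t) \<in> Pi\<^sub>E {Suc k..n} E \<longleftrightarrow> x \<in> Pi\<^sub>E {Suc (Suc k)..n} E \<and> t \<in> E (Suc k)"
          using x k unfolding space_PiM insert_tail[OF k, symmetric]
          by (auto simp: PiE_iff extensional_def)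
        then show "c * indicator (Pi\<^sub>E {Suc k..n} E) (x(Suc k := t))
            \<le> c * indicator (Pi\<^sub>E {Suc (Suc k)..n} E) x * indicator (E (Suc k)) t"
          by (auto simp: indicator_def)
      qed
      also have "\<dots> = c * e * indicator (Pi\<^sub>E {Suc (Suc k)..n} E) x"
        using k E(1)[of "Suc k"] by (subst lp_norm_cmult) (auto simp: p_Suc_pos e_def mult_ac)
      finally show "N (Suc k) (indicator (Pi\<^sub>E {1..n} E)) x \<le> c * e * indicator (Pi\<^sub>E {Suc (Suc k)..n} E) x" .
    qed
  qed
  from this[of n] obtain c where "c < top"
    "N n (indicator (Pi\<^sub>E {1..n} E)) (\<lambda>_. undefined) \<le> c * indicator (Pi\<^sub>E {Suc n..n} E) (\<lambda>_. undefined)"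
    using undefined_in_tail by blast
  then show ?thesis
    by (simp add: total_norm_def le_less_trans)
qed

end

text \<open>Otherwise \<open>{1..n}\<close> is rewritten to \<open>{Suc 0..n}\<close>, and measurability assumptions no longer match.\<close>

declare One_nat_def [simp del]

section \<open>Averages over boxes\<close>

lemma sum_indicator_disjoint_le_1:
  assumes "finite P" "disjoint P"
  shows "(\<Sum>B\<in>P. indicator B s) \<le> (1::ennreal)"
proof -
  have "(\<Sum>B\<in>P. indicator B s) = (indicator (\<Union>P) s :: ennreal)"
    using assms by (subst indicator_UN_disjoint[where f = "\<lambda>B. B", symmetric])
      (auto simp: disjoint_family_on_def disjoint_def)
  then show ?thesis by (simp add: indicator_def)
qed

lemma prod_indicator_PiE:
  assumes "finite I" "x \<in> extensional I"
  shows "(\<Prod>i\<in>I. indicator (b i) (x i)) = (indicator (Pi\<^sub>E I b) x :: 'b::comm_semiring_1)"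
proof (cases "x \<in> Pi\<^sub>E I b")
  case True
  then show ?thesis by (simp add: PiE_iff)
next
  case False
  then obtain i where "i \<in> I" "x i \<notin> b i" using assms by (auto simp: PiE_iff)
  then have "\<exists>i\<in>I. indicator (b i) (x i) = (0::'b)" by (intro bexI[of _ i]) auto
  then show ?thesis using assms False by (simp add: prod_zero)
qed

lemma LIMSEQ_scaleR_indicator:
  fixes f :: "nat \<Rightarrow> 'b::real_normed_vector"
  assumes "incseq E" "x \<in> (\<Union>m. E m)" "f \<longlonglongrightarrow> l"
  shows "(\<lambda>m. indicator (E m) x *\<^sub>R f m) \<longlonglongrightarrow> l"
proof -
  obtain m0 where "x \<in> E m0" using assms by auto
  then have "\<And>m. m0 \<le> m \<Longrightarrow> x \<in> E m" using assms(1) by (auto simp: incseq_def)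
  then have "eventually (\<lambda>m. f m = indicator (E m) x *\<^sub>R f m) sequentially"
    by (auto simp: eventually_sequentially intro!: exI[of _ m0])
  then show ?thesis using assms(3) by (rule Lim_transform_eventually[rotated])
qed

text \<open>Points are grouped by the members of \<open>D\<close> that contain them: the atoms of
  the algebra generated by \<open>D\<close>. Excluding \<open>S = {}\<close> drops the complement of
  the union, which may have infinite measure.\<close>

definition partition_cells :: "'a set set \<Rightarrow> 'a set set" where
  "partition_cells D = (\<lambda>S. \<Inter>S - \<Union>(D - S)) ` (Pow D - {{}})"

lemma finite_partition_cells: "finite D \<Longrightarrow> finite (partition_cells D)"
  by (simp add: partition_cells_def)

lemma disjoint_partition_cells: "disjoint (partition_cells D)"
proof (unfold disjoint_def, intro ballI impI)
  fix A B assume "A \<in> partition_cells D" "B \<in> partition_cells D" "A \<noteq> B"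
  then obtain S T where "S \<subseteq> D" "T \<subseteq> D" "A = \<Inter>S - \<Union>(D - S)" "B = \<Inter>T - \<Union>(D - T)"
    unfolding partition_cells_def by auto
  moreover from this \<open>A \<noteq> B\<close> obtain C where "C \<in> S \<and> C \<notin> T \<or> C \<in> T \<and> C \<notin> S" by blast
  ultimately show "A \<inter> B = {}" by blast
qed

lemma partition_cells_sets:
  assumes "finite D" "D \<subseteq> sets M" "B \<in> partition_cells D"
  shows "B \<in> sets M"
proof -
  from assms(3) obtain S where S: "S \<subseteq> D" "S \<noteq> {}" "B = \<Inter>S - \<Union>(D - S)"
    by (auto simp: partition_cells_def)
  then have "finite S" "S \<subseteq> sets M" using assms finite_subset by blast+
  then have "\<Inter>S \<in> sets M" "\<Union>(D - S) \<in> sets M"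
    using S assms sets.finite_INT[of S "\<lambda>B. B" M] by (auto intro!: sets.finite_Union)
  then show ?thesis using S by auto
qed

lemma partition_cells_subset_cases:
  assumes "B \<in> partition_cells D" "A \<in> D"
  shows "B \<subseteq> A \<or> B \<inter> A = {}"
  using assms unfolding partition_cells_def by blast

lemma partition_cells_subset_Union:
  assumes "B \<in> partition_cells D"
  shows "\<exists>A\<in>D. B \<subseteq> A"
proof -
  obtain S A where "S \<subseteq> D" "B = \<Inter>S - \<Union>(D - S)" "A \<in> S"
    using assms unfolding partition_cells_def by blast
  then show ?thesis by blast
qed

lemma partition_cells_cover:
  assumes "A \<in> D" "s \<in> A"
  shows "\<exists>B\<in>partition_cells D. s \<in> B"
proof
  let ?S = "{A\<in>D. s \<in> A}"
  have "?S \<in> Pow D - {{}}" using assms by blast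
  then show "\<Inter>?S - \<Union>(D - ?S) \<in> partition_cells D"
    unfolding partition_cells_def by (rule imageI)
  show "s \<in> \<Inter>?S - \<Union>(D - ?S)" by blast
qed

context mixed_exponents
begin

text \<open>Partitions of a part of each factor only: a space of infinite measure is not covered by
  finitely many sets of finite measure. Averages vanish off the boxes.\<close>

definition finite_partition :: "(nat \<Rightarrow> 'a set set) \<Rightarrow> bool" where
  "finite_partition P \<longleftrightarrow> (\<forall>i\<in>{1..n}. finite (P i) \<and> disjoint (P i) \<and>
     (\<forall>B\<in>P i. B \<in> sets (M i) \<and> emeasure (M i) B \<noteq> top))"

abbreviation box :: "(nat \<Rightarrow> 'a set) \<Rightarrow> (nat \<Rightarrow> 'a) set" where
  "box b \<equiv> Pi\<^sub>E {1..n} b"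

definition average ::
    "(nat \<Rightarrow> 'a set set) \<Rightarrow> ((nat \<Rightarrow> 'a) \<Rightarrow> 'b::{banach, second_countable_topology}) \<Rightarrow> (nat \<Rightarrow> 'a) \<Rightarrow> 'b" where
  "average P f x = (\<Sum>b\<in>Pi\<^sub>E {1..n} P.
     indicator (box b) x *\<^sub>R (inverse (measure \<Omega> (box b)) *\<^sub>R set_lebesgue_integral \<Omega> (box b) f))"

text \<open>The kernel of averaging in one coordinate alone. It is symmetric, so that one bound on
  marginals serves for both.\<close>

definition average_kernel :: "(nat \<Rightarrow> 'a set set) \<Rightarrow> nat \<Rightarrow> 'a \<Rightarrow> 'a \<Rightarrow> ennreal" where
  "average_kernel P i s t =
     (\<Sum>B\<in>P i. indicator B s * indicator B t * ennreal (inverse (measure (M i) B)))"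

lemma finite_partitionD:
  assumes "finite_partition P" "i \<in> {1..n}"
  shows "finite (P i)" "disjoint (P i)" "B \<in> P i \<Longrightarrow> B \<in> sets (M i)" "B \<in> P i \<Longrightarrow> emeasure (M i) B \<noteq> top"
  using assms by (auto simp: finite_partition_def)

lemma finite_boxes: "finite_partition P \<Longrightarrow> finite (Pi\<^sub>E {1..n} P)"
  by (intro finite_PiE) (auto simp: finite_partition_def)

lemma box_sets:
  assumes "finite_partition P" "b \<in> Pi\<^sub>E {1..n} P"
  shows "box b \<in> sets \<Omega>"
  using assms by (intro sets_PiM_I_finite) (auto simp: finite_partition_def PiE_iff)

lemma emeasure_box:
  assumes "finite_partition P" "b \<in> Pi\<^sub>E {1..n} P"
  shows "emeasure \<Omega> (box b) = (\<Prod>i\<in>{1..n}. emeasure (M i) (b i))"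
  using assms by (intro emeasure_PiM) (auto simp: finite_partition_def PiE_iff)

lemma emeasure_box_neq_top:
  assumes "finite_partition P" "b \<in> Pi\<^sub>E {1..n} P"
  shows "emeasure \<Omega> (box b) \<noteq> top"
  using assms unfolding emeasure_box[OF assms]
  by (auto simp: ennreal_prod_eq_top finite_partition_def PiE_iff)

lemma measure_box:
  assumes "finite_partition P" "b \<in> Pi\<^sub>E {1..n} P"
  shows "measure \<Omega> (box b) = (\<Prod>i\<in>{1..n}. measure (M i) (b i))"
proof -
  have "emeasure \<Omega> (box b) = (\<Prod>i\<in>{1..n}. ennreal (measure (M i) (b i)))"
    unfolding emeasure_box[OF assms] using assms
    by (intro prod.cong emeasure_eq_ennreal_measure) (auto simp: finite_partition_def PiE_iff)
  then show ?thesis by (simp add: measure_def prod_ennreal prod_nonneg)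
qed

text \<open>Expanding the product of sums gives one term for each choice of a side per coordinate,
  that is, for each box; the measure of a box factors in the same way.\<close>

lemma prod_average_kernel:
  assumes P: "finite_partition P" and "x \<in> space \<Omega>" "y \<in> space \<Omega>"
  shows "(\<Prod>i\<in>{1..n}. average_kernel P i (x i) (y i)) =
    (\<Sum>b\<in>Pi\<^sub>E {1..n} P. indicator (box b) x * (indicator (box b) y * ennreal (inverse (measure \<Omega> (box b)))))"
proof -
  have ext: "x \<in> extensional {1..n}" "y \<in> extensional {1..n}"
    using assms by (auto simp: space_PiM PiE_iff)
  have "(\<Prod>i\<in>{1..n}. average_kernel P i (x i) (y i)) = (\<Sum>b\<in>Pi\<^sub>E {1..n} P. \<Prod>i\<in>{1..n}.
      indicator (b i) (x i) * indicator (b i) (y i) * ennreal (inverse (measure (M i) (b i))))"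
    unfolding average_kernel_def using P by (intro prod_sum_PiE) (auto simp: finite_partition_def)
  also have "\<dots> = (\<Sum>b\<in>Pi\<^sub>E {1..n} P. indicator (box b) x * (indicator (box b) y * ennreal (inverse (measure \<Omega> (box b)))))"
  proof (rule sum.cong[OF refl])
    fix b assume b: "b \<in> Pi\<^sub>E {1..n} P"
    have "(\<Prod>i\<in>{1..n}. ennreal (inverse (measure (M i) (b i)))) = ennreal (inverse (measure \<Omega> (box b)))"
      unfolding measure_box[OF P b] prod_inversef[symmetric] by (simp add: prod_ennreal)
    then show "(\<Prod>i\<in>{1..n}. indicator (b i) (x i) * indicator (b i) (y i) * ennreal (inverse (measure (M i) (b i))))
        = indicator (box b) x * (indicator (box b) y * ennreal (inverse (measure \<Omega> (box b))))"
      using ext by (simp only: prod.distrib prod_indicator_PiE finite_atLeastAtMost mult.assoc)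
  qed
  finally show ?thesis .
qed

lemma measurable_average_kernel:
  assumes "finite_partition P" "i \<in> {1..n}"
  shows "(\<lambda>(s, t). average_kernel P i s t) \<in> borel_measurable (M i \<Otimes>\<^sub>M M i)"
proof -
  have [measurable]: "B \<in> sets (M i)" if "B \<in> P i" for B
    using finite_partitionD[OF assms] that by auto
  show ?thesis unfolding average_kernel_def by measurable
qed

lemma average_kernel_sym: "average_kernel P i s t = average_kernel P i t s"
  unfolding average_kernel_def by (simp add: mult.commute)

lemma nn_integral_average_kernel_le:
  assumes P: "finite_partition P" and i: "i \<in> {1..n}"
  shows "(\<integral>\<^sup>+t. average_kernel P i s t \<partial>M i) \<le> 1"
proof -
  note * = finite_partitionD[OF P i]
  have "(\<integral>\<^sup>+t. average_kernel P i s t \<partial>M i) =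
      (\<Sum>B\<in>P i. \<integral>\<^sup>+t. indicator B s * ennreal (inverse (measure (M i) B)) * indicator B t \<partial>M i)"
    unfolding average_kernel_def using *
    by (subst nn_integral_sum) (auto intro!: sum.cong nn_integral_cong simp: mult_ac)
  also have "\<dots> = (\<Sum>B\<in>P i. indicator B s * ennreal (inverse (measure (M i) B)) * emeasure (M i) B)"
    using * by (intro sum.cong nn_integral_cmult_indicator) auto
  also have "\<dots> \<le> (\<Sum>B\<in>P i. indicator B s)"
  proof (rule sum_mono)
    fix B assume "B \<in> P i"
    then have "emeasure (M i) B = ennreal (measure (M i) B)"
      using *(4) by (intro emeasure_eq_ennreal_measure) auto
    \<comment> \<open>The product is 1 for a cell of positive measure and 0 for a null cell, as
      \<open>inverse 0 = 0\<close>.\<close>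
    then have "ennreal (inverse (measure (M i) B)) * emeasure (M i) B \<le> 1"
      by (cases "measure (M i) B = 0") (auto simp flip: ennreal_mult)
    then show "indicator B s * ennreal (inverse (measure (M i) B)) * emeasure (M i) B \<le> indicator B s"
      by (auto simp: indicator_def)
  qed
  also have "\<dots> \<le> 1" using * by (intro sum_indicator_disjoint_le_1)
  finally show ?thesis .
qed

section \<open>The unweighted mixed-norm space and its averaging contractions\<close>

definition fnorm :: "((nat \<Rightarrow> 'a) \<Rightarrow> 'b::{real_normed_vector, second_countable_topology}) \<Rightarrow> ennreal" where
  "fnorm f = total_norm (\<lambda>x. ennreal (norm (f x)))"

definition Lp :: "((nat \<Rightarrow> 'a) \<Rightarrow> 'b::{real_normed_vector, second_countable_topology}) set" where
  "Lp = {f \<in> borel_measurable \<Omega>. fnorm f < top}"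

lemma fnorm_cong: "(\<And>x. x \<in> space \<Omega> \<Longrightarrow> norm (f x) = norm (g x)) \<Longrightarrow> fnorm f = fnorm g"
  unfolding fnorm_def by (intro total_norm_cong) auto

lemma fnorm_add_le:
  assumes [measurable]: "f \<in> borel_measurable \<Omega>" "g \<in> borel_measurable \<Omega>"
  shows "fnorm (\<lambda>x. f x + g x) \<le> fnorm f + fnorm g"
proof -
  have "fnorm (\<lambda>x. f x + g x) \<le> total_norm (\<lambda>x. ennreal (norm (f x)) + ennreal (norm (g x)))"
    unfolding fnorm_def by (intro total_norm_mono) (auto simp: norm_triangle_ineq simp flip: ennreal_plus)
  also have "\<dots> \<le> fnorm f + fnorm g"
    unfolding fnorm_def by (intro total_norm_add_le) measurable
  finally show ?thesis .
qed

lemma fnorm_scale: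
  assumes [measurable]: "f \<in> borel_measurable \<Omega>" and "\<And>x. x \<in> space \<Omega> \<Longrightarrow> norm (g x) = r * norm (f x)" "0 \<le> r"
  shows "fnorm g = ennreal r * fnorm f"
proof -
  have "fnorm g = total_norm (\<lambda>x. ennreal r * ennreal (norm (f x)))"
    unfolding fnorm_def using assms by (intro total_norm_cong) (simp add: ennreal_mult)
  then show ?thesis by (simp add: fnorm_def total_norm_cmult)
qed

lemma fnorm_eq_0_iff:
  assumes "f \<in> borel_measurable \<Omega>"
  shows "fnorm f = 0 \<longleftrightarrow> (AE x in \<Omega>. f x = 0)"
  unfolding fnorm_def using assms by (subst total_norm_eq_0_iff) auto

lemma fnorm_cong_AE:
  assumes [measurable]: "f \<in> borel_measurable \<Omega>" "g \<in> borel_measurable \<Omega>"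
    and "AE x in \<Omega>. f x = g x"
  shows "fnorm f = fnorm g"
proof -
  have le: "fnorm f \<le> fnorm g"
    if [measurable]: "f \<in> borel_measurable \<Omega>" "g \<in> borel_measurable \<Omega>" and "AE x in \<Omega>. f x = g x"
    for f g :: "(nat \<Rightarrow> 'a) \<Rightarrow> 'b"
  proof -
    have "fnorm (\<lambda>x. f x - g x) = 0" using that by (subst fnorm_eq_0_iff) auto
    then show ?thesis using fnorm_add_le[of "\<lambda>x. f x - g x" g] by simp
  qed
  have "AE x in \<Omega>. g x = f x" using assms(3) by eventually_elim simp
  then show ?thesis using assms by (intro antisym le)
qed

lemma fnorm_minus_commute: "fnorm (\<lambda>x. f x - g x) = fnorm (\<lambda>x. g x - f x)"
  by (intro fnorm_cong) (rule norm_minus_commute)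

lemma Lp_measurable [measurable_dest]: "f \<in> Lp \<Longrightarrow> f \<in> borel_measurable \<Omega>"
  by (simp add: Lp_def)

lemma Lp_add: "f \<in> Lp \<Longrightarrow> g \<in> Lp \<Longrightarrow> (\<lambda>x. f x + g x) \<in> Lp"
  using fnorm_add_le[of f g] by (auto simp: Lp_def intro: le_less_trans)

lemma Lp_scaleR: "f \<in> Lp \<Longrightarrow> (\<lambda>x. r *\<^sub>R f x) \<in> Lp"
  using fnorm_scale[of f "\<lambda>x. r *\<^sub>R f x" "\<bar>r\<bar>"] by (auto simp: Lp_def ennreal_mult_less_top)

lemma Lp_diff: "f \<in> Lp \<Longrightarrow> g \<in> Lp \<Longrightarrow> (\<lambda>x. f x - g x) \<in> Lp"
  using Lp_add[of f "\<lambda>x. (-1) *\<^sub>R g x"] Lp_scaleR[of g "-1"] by simp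

lemma Lp_cmult:
  fixes f :: "(nat \<Rightarrow> 'a) \<Rightarrow> 'b::{real_normed_field, second_countable_topology}"
  shows "f \<in> Lp \<Longrightarrow> (\<lambda>x. c * f x) \<in> Lp"
  using fnorm_scale[of f "\<lambda>x. c * f x" "norm c"] by (auto simp: Lp_def ennreal_mult_less_top norm_mult)

lemma measurable_average:
  assumes P: "finite_partition P"
  shows "average P f \<in> borel_measurable \<Omega>"
proof -
  note [measurable] = box_sets[OF P]
  show ?thesis unfolding average_def by measurable
qed

lemma norm_average_le:
  fixes f :: "(nat \<Rightarrow> 'a) \<Rightarrow> 'b::{banach, second_countable_topology}"
  assumes P: "finite_partition P" and [measurable]: "f \<in> borel_measurable \<Omega>" and x: "x \<in> space \<Omega>"
  shows "ennreal (norm (average P f x)) \<le>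
    (\<integral>\<^sup>+y. ennreal (norm (f y)) * (\<Prod>i\<in>{1..n}. average_kernel P i (x i) (y i)) \<partial>\<Omega>)"
proof -
  note [measurable] = box_sets[OF P]
  let ?c = "\<lambda>b. inverse (measure \<Omega> (box b))"
  \<comment> \<open>The integral of a nonintegrable function is 0 by convention, so the bound holds
    before integrability over boxes is known.\<close>
  have int: "ennreal (norm (set_lebesgue_integral \<Omega> (box b) f)) \<le> (\<integral>\<^sup>+y. ennreal (norm (f y)) * indicator (box b) y \<partial>\<Omega>)" for b
  proof (cases "integrable \<Omega> (\<lambda>y. indicator (box b) y *\<^sub>R f y)")
    case True
    have "ennreal (norm (set_lebesgue_integral \<Omega> (box b) f)) \<le> (\<integral>\<^sup>+y. norm (indicator (box b) y *\<^sub>R f y) \<partial>\<Omega>)"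
      unfolding set_lebesgue_integral_def by (rule integral_norm_bound_ennreal[OF True])
    also have "\<dots> = (\<integral>\<^sup>+y. ennreal (norm (f y)) * indicator (box b) y \<partial>\<Omega>)"
      by (intro nn_integral_cong) (auto simp: indicator_def)
    finally show ?thesis .
  qed (simp add: set_lebesgue_integral_def not_integrable_integral_eq)
  have "norm (average P f x) \<le> (\<Sum>b\<in>Pi\<^sub>E {1..n} P.
      indicator (box b) x * (?c b * norm (set_lebesgue_integral \<Omega> (box b) f)))"
    unfolding average_def by (intro order_trans[OF norm_sum] sum_mono) simp
  then have "ennreal (norm (average P f x)) \<le> (\<Sum>b\<in>Pi\<^sub>E {1..n} P.
      ennreal (indicator (box b) x * (?c b * norm (set_lebesgue_integral \<Omega> (box b) f))))"
    by (subst sum_ennreal) (auto intro!: ennreal_leI)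
  also have "\<dots> \<le> (\<Sum>b\<in>Pi\<^sub>E {1..n} P. \<integral>\<^sup>+y. ennreal (norm (f y)) *
      (indicator (box b) x * (indicator (box b) y * ennreal (?c b))) \<partial>\<Omega>)"
  proof (rule sum_mono)
    fix b assume [simp]: "b \<in> Pi\<^sub>E {1..n} P"
    have "ennreal (indicator (box b) x * (?c b * norm (set_lebesgue_integral \<Omega> (box b) f)))
        = indicator (box b) x * ennreal (?c b) * ennreal (norm (set_lebesgue_integral \<Omega> (box b) f))"
      by (simp add: ennreal_mult ennreal_indicator mult.assoc)
    also have "\<dots> \<le> indicator (box b) x * ennreal (?c b) * (\<integral>\<^sup>+y. ennreal (norm (f y)) * indicator (box b) y \<partial>\<Omega>)"
      by (intro mult_left_mono int) auto
    also have "\<dots> = (\<integral>\<^sup>+y. ennreal (norm (f y)) * (indicator (box b) x * (indicator (box b) y * ennreal (?c b))) \<partial>\<Omega>)"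
      by (subst nn_integral_cmult[symmetric]) (auto intro!: nn_integral_cong simp: mult_ac)
    finally show "ennreal (indicator (box b) x * (?c b * norm (set_lebesgue_integral \<Omega> (box b) f))) \<le>
      (\<integral>\<^sup>+y. ennreal (norm (f y)) * (indicator (box b) x * (indicator (box b) y * ennreal (?c b))) \<partial>\<Omega>)" .
  qed
  also have "\<dots> = (\<integral>\<^sup>+y. ennreal (norm (f y)) * (\<Prod>i\<in>{1..n}. average_kernel P i (x i) (y i)) \<partial>\<Omega>)"
    by (subst nn_integral_sum[symmetric])
      (auto intro!: nn_integral_cong simp: prod_average_kernel[OF P x] sum_distrib_left)
  finally show ?thesis .
qed

lemma total_norm_average_kernel_le:
  assumes "finite_partition P" "g \<in> borel_measurable \<Omega>"
  shows "total_norm (\<lambda>x. \<integral>\<^sup>+y. g y * (\<Prod>i\<in>{1..n}. average_kernel P i (x i) (y i)) \<partial>\<Omega>) \<le> total_norm g"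
proof (rule total_norm_kernel_le)
  fix i t assume i: "i \<in> {1..n}"
  show "(\<integral>\<^sup>+s. average_kernel P i s t \<partial>M i) \<le> 1"
    by (subst average_kernel_sym) (rule nn_integral_average_kernel_le[OF assms(1) i])
qed (use assms in \<open>auto intro: nn_integral_average_kernel_le measurable_average_kernel\<close>)

lemma fnorm_average_le:
  assumes P: "finite_partition P" and [measurable]: "f \<in> borel_measurable \<Omega>"
  shows "fnorm (average P f) \<le> fnorm f"
proof -
  have "fnorm (average P f) \<le>
      total_norm (\<lambda>x. \<integral>\<^sup>+y. ennreal (norm (f y)) * (\<Prod>i\<in>{1..n}. average_kernel P i (x i) (y i)) \<partial>\<Omega>)"
    unfolding fnorm_def by (intro total_norm_mono norm_average_le P) auto
  also have "\<dots> \<le> fnorm f"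
    unfolding fnorm_def by (intro total_norm_average_kernel_le P) auto
  finally show ?thesis .
qed

lemma average_Lp: "finite_partition P \<Longrightarrow> f \<in> Lp \<Longrightarrow> average P f \<in> Lp"
  using fnorm_average_le[of P f] measurable_average[of P f] by (auto simp: Lp_def intro: le_less_trans)

text \<open>Local integrability of functions in \<open>Lp\<close> is itself a consequence of the contraction property.\<close>

lemma Lp_set_integrable_box:
  fixes f :: "(nat \<Rightarrow> 'a) \<Rightarrow> 'b::{banach, second_countable_topology}"
  assumes P: "finite_partition P" and b: "b \<in> Pi\<^sub>E {1..n} P" and f: "f \<in> Lp"
  shows "set_integrable \<Omega> (box b) f"
proof -
  note [measurable] = box_sets[OF P b] Lp_measurable[OF f]
  let ?I = "\<integral>\<^sup>+y. ennreal (norm (f y)) * indicator (box b) y \<partial>\<Omega>"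
  let ?c = "ennreal (inverse (measure \<Omega> (box b)))"
  have "?I < top"
  proof (cases "emeasure \<Omega> (box b) = 0")
    case True
    then have "AE y in \<Omega>. y \<notin> box b" by (intro AE_not_in) auto
    then have "?I = (\<integral>\<^sup>+y. 0 \<partial>\<Omega>)" by (intro nn_integral_cong_AE) auto
    then show ?thesis by simp
  next
    case False
    then have "measure \<Omega> (box b) \<noteq> 0"
      using emeasure_box_neq_top[OF P b] by (simp add: emeasure_eq_ennreal_measure)
    \<comment> \<open>The box \<open>b\<close> contributes one term to the kernel integral of
      \<open>f\<close>, and that integral has finite norm. The term is \<open>?c * ?I\<close> times
      the indicator of the box; neither \<open>?c\<close> nor the norm of the indicator is 0, so
      \<open>?I\<close> is finite.\<close>
    have "(?c * ?I) * total_norm (indicator (box b)) = total_norm (\<lambda>x. (?c * ?I) * indicator (box b) x)"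
      by (rule total_norm_cmult[symmetric]) auto
    also have "\<dots> \<le> total_norm (\<lambda>x. \<integral>\<^sup>+y. ennreal (norm (f y)) * (\<Prod>i\<in>{1..n}. average_kernel P i (x i) (y i)) \<partial>\<Omega>)"
    proof (rule total_norm_mono)
      fix x assume x: "x \<in> space \<Omega>"
      have "(?c * ?I) * indicator (box b) x = (\<integral>\<^sup>+y. (?c * indicator (box b) x) * (ennreal (norm (f y)) * indicator (box b) y) \<partial>\<Omega>)"
        by (subst nn_integral_cmult) (auto simp: mult_ac)
      also have "\<dots> \<le> (\<integral>\<^sup>+y. ennreal (norm (f y)) * (\<Prod>i\<in>{1..n}. average_kernel P i (x i) (y i)) \<partial>\<Omega>)"
      proof (rule nn_integral_mono)
        fix y assume y: "y \<in> space \<Omega>"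
        have "indicator (box b) x * (indicator (box b) y * ?c) \<le> (\<Prod>i\<in>{1..n}. average_kernel P i (x i) (y i))"
          unfolding prod_average_kernel[OF P x y] by (rule member_le_sum) (use b finite_boxes[OF P] in auto)
        then show "(?c * indicator (box b) x) * (ennreal (norm (f y)) * indicator (box b) y)
            \<le> ennreal (norm (f y)) * (\<Prod>i\<in>{1..n}. average_kernel P i (x i) (y i))"
          using mult_left_mono[of "indicator (box b) x * (indicator (box b) y * ?c)"
              "\<Prod>i\<in>{1..n}. average_kernel P i (x i) (y i)" "ennreal (norm (f y))"]
          by (simp add: mult_ac)
      qed
      finally show "(?c * ?I) * indicator (box b) x
          \<le> (\<integral>\<^sup>+y. ennreal (norm (f y)) * (\<Prod>i\<in>{1..n}. average_kernel P i (x i) (y i)) \<partial>\<Omega>)" .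
    qed
    also have "\<dots> \<le> fnorm f"
      unfolding fnorm_def by (intro total_norm_average_kernel_le P) auto
    also have "\<dots> < top" using f by (simp add: Lp_def)
    finally have "(?c * ?I) * total_norm (indicator (box b)) < top" .
    moreover have "total_norm (indicator (box b)) \<noteq> 0"
    proof
      assume "total_norm (indicator (box b)) = 0"
      then have "AE x in \<Omega>. x \<notin> box b"
        by (subst (asm) total_norm_eq_0_iff) (auto simp: indicator_eq_0_iff)
      then have "box b \<in> null_sets \<Omega>" using AE_iff_null_sets[OF box_sets[OF P b]] by blast
      then show False using False by auto
    qed
    moreover have "?c \<noteq> 0" using \<open>measure \<Omega> (box b) \<noteq> 0\<close> by (simp add: ennreal_eq_0_iff not_le zero_less_measure_iff)
    ultimately show ?thesis by (auto simp: ennreal_mult_less_top top.not_eq_extremum ennreal_mult_eq_top_iff less_top)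
  qed
  then show ?thesis
    unfolding set_integrable_def integrable_iff_bounded
    by (auto simp: indicator_mult_ennreal ennreal_mult ennreal_indicator mult.commute)
qed

lemma average_add:
  assumes P: "finite_partition P" and "f \<in> Lp" "g \<in> Lp"
  shows "average P (\<lambda>x. f x + g x) x = average P f x + average P g x"
  unfolding average_def
  by (simp add: set_integral_add Lp_set_integrable_box[OF P] assms scaleR_add_right sum.distrib)

lemma average_diff:
  assumes P: "finite_partition P" and "f \<in> Lp" "g \<in> Lp"
  shows "average P (\<lambda>x. f x - g x) x = average P f x - average P g x"
  unfolding average_def
  by (simp add: set_integral_diff Lp_set_integrable_box[OF P] assms scaleR_diff_right sum_subtractf)

lemma average_cmult:
  fixes f :: "(nat \<Rightarrow> 'a) \<Rightarrow> 'b::{real_normed_field, banach, second_countable_topology}"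
  shows "average P (\<lambda>x. c * f x) x = c * average P f x"
  unfolding average_def by (simp add: set_integral_mult_right sum_distrib_left)

lemma average_scaleR: "average P (\<lambda>x. c *\<^sub>R f x) x = c *\<^sub>R average P f x"
  unfolding average_def by (simp add: set_integral_scaleR_right scaleR_sum_right mult_ac)

text \<open>An average sees its argument only through integrals over boxes, hence equality at every
  point. This lets averaging act on classes.\<close>

lemma average_cong_AE:
  assumes P: "finite_partition P" and [measurable]: "f \<in> borel_measurable \<Omega>" "g \<in> borel_measurable \<Omega>"
    and "AE x in \<Omega>. f x = g x"
  shows "average P f = average P g"
proof
  fix x
  have "set_lebesgue_integral \<Omega> (box b) f = set_lebesgue_integral \<Omega> (box b) g" if "b \<in> Pi\<^sub>E {1..n} P" for b
    using box_sets[OF P that] assms(4) unfolding set_lebesgue_integral_def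
    by (intro integral_cong_AE) auto
  then show "average P f x = average P g x" unfolding average_def by simp
qed

section \<open>Convergence of averages as the families of sides grow\<close>

definition finite_sides :: "(nat \<times> 'a set) set" where
  "finite_sides = {(i, B). i \<in> {1..n} \<and> B \<in> sets (M i) \<and> emeasure (M i) B \<noteq> top}"

text \<open>One set of labelled sides encodes a family for every coordinate at once, so inclusion of
  such sets gives a single directed order on all systems of families.\<close>

definition cells :: "(nat \<times> 'a set) set \<Rightarrow> nat \<Rightarrow> 'a set set" where
  "cells D i = partition_cells (D `` {i})"

definition approximable :: "((nat \<Rightarrow> 'a) \<Rightarrow> 'b::{banach, second_countable_topology}) \<Rightarrow> bool" where
  "approximable f \<longleftrightarrow> f \<in> Lp \<and> (\<forall>e>0. eventually
     (\<lambda>D. fnorm (\<lambda>x. f x - average (cells D) f x) < ennreal e) (finite_subsets_at_top finite_sides))"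

lemma finite_partition_cells_sides:
  assumes "finite D" "D \<subseteq> finite_sides"
  shows "finite_partition (cells D)"
  unfolding finite_partition_def
proof (intro ballI conjI)
  fix i assume i: "i \<in> {1..n}"
  have fin: "finite (D `` {i})" using assms(1) by (rule finite_Image)
  have sub: "D `` {i} \<subseteq> sets (M i)" using assms(2) by (auto simp: finite_sides_def)
  show "finite (cells D i)" "disjoint (cells D i)"
    unfolding cells_def using fin by (simp_all add: finite_partition_cells disjoint_partition_cells)
  fix B assume "B \<in> cells D i"
  then have B: "B \<in> partition_cells (D `` {i})" by (simp add: cells_def)
  show "B \<in> sets (M i)" using fin sub B by (rule partition_cells_sets)
  obtain A where A: "A \<in> D `` {i}" "B \<subseteq> A" using partition_cells_subset_Union[OF B] by auto
  then have "emeasure (M i) B \<le> emeasure (M i) A" using sub by (intro emeasure_mono) auto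
  moreover have "emeasure (M i) A \<noteq> top" using A(1) assms(2) by (auto simp: finite_sides_def)
  ultimately show "emeasure (M i) B \<noteq> top" by (auto simp: top_unique)
qed

lemma eventually_finite_sides:
  "eventually (\<lambda>D. finite_partition (cells D)) (finite_subsets_at_top finite_sides)"
  by (rule eventually_finite_subsets_at_top_weakI) (rule finite_partition_cells_sides)

lemma approximable_Lp: "approximable f \<Longrightarrow> f \<in> Lp"
  by (simp add: approximable_def)

text \<open>Inserts \<open>g\<close> and its average; by contractivity the average of
  \<open>g - f\<close> costs no more than \<open>g - f\<close>. This gives both closedness of the
  approximable functions and the passage from a finite net to a compact set.\<close>

lemma fnorm_average_error_le:
  assumes P: "finite_partition P" and f: "f \<in> Lp" and g: "g \<in> Lp"
  shows "fnorm (\<lambda>x. f x - average P f x) \<le>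
    fnorm (\<lambda>x. f x - g x) + fnorm (\<lambda>x. g x - average P g x) + fnorm (\<lambda>x. f x - g x)"
proof -
  note [measurable] = Lp_measurable[OF f] Lp_measurable[OF g] measurable_average[OF P]
  have "(\<lambda>x. f x - average P f x) =
      (\<lambda>x. ((f x - g x) + (g x - average P g x)) + average P (\<lambda>x. g x - f x) x)"
    using average_diff[OF P g f] by auto
  then have "fnorm (\<lambda>x. f x - average P f x) \<le>
      fnorm (\<lambda>x. (f x - g x) + (g x - average P g x)) + fnorm (average P (\<lambda>x. g x - f x))"
    using fnorm_add_le[of "\<lambda>x. (f x - g x) + (g x - average P g x)" "average P (\<lambda>x. g x - f x)"] by simp
  also have "\<dots> \<le> (fnorm (\<lambda>x. f x - g x) + fnorm (\<lambda>x. g x - average P g x)) + fnorm (\<lambda>x. g x - f x)"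
    by (intro add_mono fnorm_add_le fnorm_average_le P) measurable
  finally show ?thesis by (simp add: fnorm_minus_commute[of g f])
qed

lemma approximable_closed:
  assumes f: "f \<in> Lp" and dense: "\<And>e. 0 < e \<Longrightarrow> \<exists>g. approximable g \<and> fnorm (\<lambda>x. f x - g x) < ennreal e"
  shows "approximable f"
  unfolding approximable_def
proof (intro conjI allI impI f)
  fix e :: real assume e: "0 < e"
  obtain g where g: "approximable g" "fnorm (\<lambda>x. f x - g x) < ennreal (e / 3)"
    using dense[of "e / 3"] e by auto
  have "eventually (\<lambda>D. fnorm (\<lambda>x. g x - average (cells D) g x) < ennreal (e / 3)) (finite_subsets_at_top finite_sides)"
    using g(1) e by (simp add: approximable_def)
  then show "eventually (\<lambda>D. fnorm (\<lambda>x. f x - average (cells D) f x) < ennreal e) (finite_subsets_at_top finite_sides)"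
    using eventually_finite_sides
  proof eventually_elim
    case (elim D)
    have "fnorm (\<lambda>x. f x - average (cells D) f x) \<le>
        fnorm (\<lambda>x. f x - g x) + fnorm (\<lambda>x. g x - average (cells D) g x) + fnorm (\<lambda>x. f x - g x)"
      using elim f approximable_Lp[OF g(1)] by (intro fnorm_average_error_le)
    also have "\<dots> < ennreal (e / 3) + ennreal (e / 3) + ennreal (e / 3)"
      using elim g by (intro add_strict_mono)
    also have "\<dots> = ennreal e" using e by (simp flip: ennreal_plus)
    finally show ?case .
  qed
qed

lemma approximable_add:
  assumes f: "approximable f" and g: "approximable g"
  shows "approximable (\<lambda>x. f x + g x)"
  unfolding approximable_def
proof (intro conjI allI impI Lp_add approximable_Lp f g)
  fix e :: real assume e: "0 < e"
  have "eventually (\<lambda>D. fnorm (\<lambda>x. f x - average (cells D) f x) < ennreal (e / 2)) (finite_subsets_at_top finite_sides)"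
    "eventually (\<lambda>D. fnorm (\<lambda>x. g x - average (cells D) g x) < ennreal (e / 2)) (finite_subsets_at_top finite_sides)"
    using f g e by (simp_all add: approximable_def)
  then show "eventually (\<lambda>D. fnorm (\<lambda>x. (f x + g x) - average (cells D) (\<lambda>x. f x + g x) x) < ennreal e) (finite_subsets_at_top finite_sides)"
    using eventually_finite_sides
  proof eventually_elim
    case (elim D)
    note [measurable] = measurable_average[OF elim(3)] approximable_Lp[OF f, THEN Lp_measurable]
      approximable_Lp[OF g, THEN Lp_measurable]
    have "(\<lambda>x. (f x + g x) - average (cells D) (\<lambda>x. f x + g x) x) =
        (\<lambda>x. (f x - average (cells D) f x) + (g x - average (cells D) g x))"
      using elim f g by (simp add: average_add approximable_Lp algebra_simps)
    then have "fnorm (\<lambda>x. (f x + g x) - average (cells D) (\<lambda>x. f x + g x) x) \<le>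
        fnorm (\<lambda>x. f x - average (cells D) f x) + fnorm (\<lambda>x. g x - average (cells D) g x)"
      using fnorm_add_le[of "\<lambda>x. f x - average (cells D) f x" "\<lambda>x. g x - average (cells D) g x"] by simp
    also have "\<dots> < ennreal (e / 2) + ennreal (e / 2)"
      using elim by (intro add_strict_mono)
    also have "\<dots> = ennreal e" using e by (simp flip: ennreal_plus)
    finally show ?case .
  qed
qed

lemma approximable_uminus:
  assumes f: "approximable f"
  shows "approximable (\<lambda>x. - f x)"
proof -
  have "(\<lambda>x. - f x) \<in> Lp" using Lp_scaleR[OF approximable_Lp[OF f], of "-1"] by simp
  moreover have "average P (\<lambda>x. - f x) x = - average P f x" for P x
    using average_scaleR[of P "-1" f x] by simp
  moreover have "fnorm (\<lambda>x. - f x + average P f x) = fnorm (\<lambda>x. f x - average P f x)" for P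
    by (intro fnorm_cong) (simp add: norm_minus_commute)
  ultimately show ?thesis using f by (simp add: approximable_def)
qed

lemma approximable_0: "approximable (\<lambda>x. 0)"
proof -
  have "fnorm (\<lambda>x. 0 :: 'b) = 0" by (subst fnorm_eq_0_iff) auto
  moreover have "average P (\<lambda>x. 0 :: 'b) x = 0" for P x
    by (simp add: average_def set_lebesgue_integral_def)
  ultimately show ?thesis by (simp add: approximable_def Lp_def)
qed

lemma approximable_sum:
  assumes "\<And>i. i \<in> I \<Longrightarrow> approximable (f i)"
  shows "approximable (\<lambda>x. \<Sum>i\<in>I. f i x)"
  using assms by (induction I rule: infinite_finite_induct) (auto intro: approximable_0 approximable_add)

text \<open>The majorant passes to the limit, so \<open>2 * h\<close> dominates the differences.
  Dominated convergence turns pointwise convergence into convergence in norm, and closedness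
  applies.\<close>

lemma approximable_dominated_limit:
  fixes f :: "(nat \<Rightarrow> 'a) \<Rightarrow> 'b::{banach, second_countable_topology}"
  assumes F: "\<And>m. approximable (F m)" and [measurable]: "f \<in> borel_measurable \<Omega>" "h \<in> borel_measurable \<Omega>"
    and h: "total_norm h < top" and bound: "\<And>m x. x \<in> space \<Omega> \<Longrightarrow> ennreal (norm (F m x)) \<le> h x"
    and lim: "\<And>x. x \<in> space \<Omega> \<Longrightarrow> (\<lambda>m. F m x) \<longlonglongrightarrow> f x"
  shows "approximable f"
proof (rule approximable_closed)
  note [measurable] = approximable_Lp[OF F, THEN Lp_measurable]
  have f_le: "ennreal (norm (f x)) \<le> h x" if "x \<in> space \<Omega>" for x
  proof (rule LIMSEQ_le_const2)
    show "(\<lambda>m. ennreal (norm (F m x))) \<longlonglongrightarrow> ennreal (norm (f x))"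
      using lim[OF that] by (intro tendsto_intros)
  qed (use bound that in auto)
  have "fnorm f \<le> total_norm h"
    unfolding fnorm_def by (intro total_norm_mono f_le)
  then show "f \<in> Lp" using h by (simp add: Lp_def le_less_trans)
  have "(\<lambda>m. total_norm (\<lambda>x. ennreal (norm (f x - F m x)))) \<longlonglongrightarrow> 0"
  proof (rule total_norm_tendsto_0)
    show "ennreal (norm (f x - F m x)) \<le> 2 * h x" if "x \<in> space \<Omega>" for m x
    proof -
      have "ennreal (norm (f x - F m x)) \<le> ennreal (norm (f x)) + ennreal (norm (F m x))"
        by (simp add: norm_triangle_ineq4 flip: ennreal_plus)
      also have "\<dots> \<le> h x + h x" using that by (intro add_mono f_le bound)
      finally show ?thesis by (simp add: mult_2)
    qed
    show "total_norm (\<lambda>x. 2 * h x) < top"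
      using h by (simp add: total_norm_cmult ennreal_mult_less_top)
    show "(\<lambda>m. ennreal (norm (f x - F m x))) \<longlonglongrightarrow> 0" if "x \<in> space \<Omega>" for x
      using tendsto_ennrealI[OF tendsto_norm[OF tendsto_diff[OF tendsto_const[of "f x"] lim[OF that]]]] by simp
  qed measurable
  then show "\<exists>g. approximable g \<and> fnorm (\<lambda>x. f x - g x) < ennreal e" if "0 < e" for e
    using order_tendstoD(2)[of _ 0 sequentially "ennreal e"] that F
    by (fastforce simp: fnorm_def eventually_sequentially)
qed

text \<open>
  The indicator of a box is a fixed point, up to null sets, of every averaging operator that is
  fine enough. Cells of measure zero contribute nothing to \<open>average\<close>, because there
  \<open>inverse 0 = 0\<close>.
\<close>

lemma average_box_AE:
  fixes c :: "'b::{banach, second_countable_topology}"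
  assumes D: "finite D" "D \<subseteq> finite_sides" and A: "\<And>i. i \<in> {1..n} \<Longrightarrow> (i, A i) \<in> D"
  shows "AE x in \<Omega>. average (cells D) (\<lambda>x. indicator (box A) x *\<^sub>R c) x = indicator (box A) x *\<^sub>R c"
proof -
  have P: "finite_partition (cells D)" using D by (rule finite_partition_cells_sides)
  have A_sets: "A i \<in> sets (M i)" if "i \<in> {1..n}" for i
    using A[OF that] D by (auto simp: finite_sides_def)
  have [measurable]: "box A \<in> sets \<Omega>" by (intro sets_PiM_I_finite A_sets) auto
  let ?B = "Pi\<^sub>E {1..n} (cells D)"
  \<comment> \<open>There are only finitely many boxes, so almost every point avoids all null ones,
    and the measure of a box containing it can be cancelled.\<close>
  have "AE x in \<Omega>. \<forall>b\<in>?B. measure \<Omega> (box b) = 0 \<longrightarrow> x \<notin> box b"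
  proof (rule AE_finite_allI[OF finite_boxes[OF P]])
    fix b assume b: "b \<in> ?B"
    show "AE x in \<Omega>. measure \<Omega> (box b) = 0 \<longrightarrow> x \<notin> box b"
    proof (cases "measure \<Omega> (box b) = 0")
      case True
      then have "emeasure \<Omega> (box b) = 0"
        using emeasure_box_neq_top[OF P b] by (simp add: emeasure_eq_ennreal_measure)
      then have "AE x in \<Omega>. x \<notin> box b" using box_sets[OF P b] by (intro AE_not_in) auto
      then show ?thesis by eventually_elim simp
    qed simp
  qed
  then show ?thesis
    using AE_space
  proof eventually_elim
    case (elim x)
    have ext: "x \<in> extensional {1..n}" using elim by (simp add: space_PiM PiE_iff)
    \<comment> \<open>Each \<open>A i\<close> is one of the generating sides, so a cell lies inside
      it or misses it; one coordinate in which the cell misses \<open>A i\<close> already separates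
      the boxes.\<close>
    have cases: "box b \<inter> box A = box b \<or> box b \<inter> box A = {}" if "b \<in> ?B" for b
    proof (cases "\<forall>i\<in>{1..n}. b i \<subseteq> A i")
      case True
      then have "box b \<subseteq> box A" by (intro PiE_mono) auto
      then show ?thesis by auto
    next
      case False
      then obtain i where i: "i \<in> {1..n}" "\<not> b i \<subseteq> A i" by blast
      then have "b i \<inter> A i = {}"
        using partition_cells_subset_cases[of "b i" "D `` {i}" "A i"] A[of i] that
        by (auto simp: cells_def PiE_iff)
      then show ?thesis using i(1) by (blast dest: PiE_mem)
    qed
    have coeff: "inverse (measure \<Omega> (box b)) *\<^sub>R set_lebesgue_integral \<Omega> (box b) (\<lambda>x. indicator (box A) x *\<^sub>R c)
        = indicator (box A) x *\<^sub>R c" if "b \<in> ?B" "x \<in> box b" for b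
    proof -
      have "set_lebesgue_integral \<Omega> (box b) (\<lambda>x. indicator (box A) x *\<^sub>R c) =
          (\<integral>y. indicator (box b \<inter> box A) y *\<^sub>R c \<partial>\<Omega>)"
        unfolding set_lebesgue_integral_def by (simp add: indicator_inter_arith)
      also have "\<dots> = measure \<Omega> (box b \<inter> box A) *\<^sub>R c"
        using cases[OF that(1)] box_sets[OF P that(1)] emeasure_box_neq_top[OF P that(1)]
        by (intro has_bochner_integral_integral_eq has_bochner_integral_indicator) (auto simp: top.not_eq_extremum)
      finally have "set_lebesgue_integral \<Omega> (box b) (\<lambda>x. indicator (box A) x *\<^sub>R c) = measure \<Omega> (box b \<inter> box A) *\<^sub>R c" .
      moreover have "measure \<Omega> (box b) \<noteq> 0" using elim(1) that by auto
      moreover have "x \<in> box A \<and> box b \<inter> box A = box b \<or> x \<notin> box A \<and> box b \<inter> box A = {}"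
        using cases[OF that(1)] that(2) by blast
      ultimately show ?thesis by (elim disjE conjE) simp_all
    qed
    show ?case
    proof (cases "x \<in> box A")
      case False
      then show ?thesis unfolding average_def using coeff
        by (auto intro!: sum.neutral simp: indicator_def)
    next
      case True
      have "\<exists>B\<in>cells D i. x i \<in> B" if "i \<in> {1..n}" for i
        unfolding cells_def using True that A[OF that] by (intro partition_cells_cover[of "A i"]) (auto simp: PiE_iff)
      then obtain b' where b': "\<And>i. i \<in> {1..n} \<Longrightarrow> b' i \<in> cells D i \<and> x i \<in> b' i" by metis
      \<comment> \<open>Members of \<open>Pi\<^sub>E\<close> are fixed outside the index set; only
        after restriction is the box around \<open>x\<close> given by a unique function.\<close>
      define b where "b = restrict b' {1..n}"
      have b: "b \<in> ?B" "x \<in> box b" using b' ext by (auto simp: b_def PiE_iff)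
      have uniq: "d = b" if d: "d \<in> ?B" "x \<in> box d" for d
      proof (rule PiE_ext[OF d(1) b(1)])
        fix i assume i: "i \<in> {1..n}"
        have "x i \<in> d i \<inter> b i" using d b i by (auto simp: PiE_iff)
        moreover have "d i \<in> cells D i" "b i \<in> cells D i" using d b i by (auto simp: PiE_iff)
        ultimately show "d i = b i"
          using finite_partitionD(2)[OF P i] unfolding disjoint_def by blast
      qed
      have "average (cells D) (\<lambda>x. indicator (box A) x *\<^sub>R c) x =
          (\<Sum>d\<in>?B. if d = b then indicator (box A) x *\<^sub>R c else 0)"
        unfolding average_def
      proof (rule sum.cong[OF refl])
        fix d assume d: "d \<in> ?B"
        show "indicator (box d) x *\<^sub>R (inverse (measure \<Omega> (box d)) *\<^sub>R
            set_lebesgue_integral \<Omega> (box d) (\<lambda>x. indicator (box A) x *\<^sub>R c)) =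
          (if d = b then indicator (box A) x *\<^sub>R c else 0)"
        proof (cases "x \<in> box d")
          case True
          then show ?thesis using uniq[OF d True] coeff[OF d True] by simp
        next
          case False
          then show ?thesis using b by auto
        qed
      qed
      also have "\<dots> = indicator (box A) x *\<^sub>R c" using b finite_boxes[OF P] by simp
      finally show ?thesis .
    qed
  qed
qed

lemma Lp_box:
  assumes "\<And>i. i \<in> {1..n} \<Longrightarrow> A i \<in> sets (M i)" "\<And>i. i \<in> {1..n} \<Longrightarrow> emeasure (M i) (A i) \<noteq> top"
  shows "(\<lambda>x. indicator (box A) x *\<^sub>R c) \<in> Lp"
proof -
  have [measurable]: "box A \<in> sets \<Omega>" using assms by (intro sets_PiM_I_finite) auto
  have "fnorm (\<lambda>x. indicator (box A) x *\<^sub>R c) = total_norm (\<lambda>x. ennreal (norm c) * indicator (box A) x)"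
    unfolding fnorm_def by (intro total_norm_cong) (auto simp: indicator_def)
  also have "\<dots> = ennreal (norm c) * total_norm (indicator (box A))" by (rule total_norm_cmult) auto
  also have "\<dots> < top"
    using total_norm_box_less_top[of A] assms by (auto simp: ennreal_mult_less_top less_top)
  finally show ?thesis by (simp add: Lp_def)
qed

lemma approximable_box:
  assumes A: "\<And>i. i \<in> {1..n} \<Longrightarrow> A i \<in> sets (M i)" "\<And>i. i \<in> {1..n} \<Longrightarrow> emeasure (M i) (A i) \<noteq> top"
  shows "approximable (\<lambda>x. indicator (box A) x *\<^sub>R c)"
  unfolding approximable_def
proof (intro conjI allI impI Lp_box A)
  fix e :: real assume "0 < e"
  \<comment> \<open>From the moment all sides of the box belong to the family, the error is exactly
    0.\<close>
  let ?D = "(\<lambda>i. (i, A i)) ` {1..n}"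
  have [measurable]: "box A \<in> sets \<Omega>" using A by (intro sets_PiM_I_finite) auto
  show "eventually (\<lambda>D. fnorm (\<lambda>x. indicator (box A) x *\<^sub>R c - average (cells D) (\<lambda>x. indicator (box A) x *\<^sub>R c) x) < ennreal e)
      (finite_subsets_at_top finite_sides)"
    unfolding eventually_finite_subsets_at_top
  proof (intro exI[of _ ?D] conjI allI impI)
    show "?D \<subseteq> finite_sides" using A by (auto simp: finite_sides_def)
    fix D assume D: "finite D \<and> ?D \<subseteq> D \<and> D \<subseteq> finite_sides"
    then have "AE x in \<Omega>. average (cells D) (\<lambda>x. indicator (box A) x *\<^sub>R c) x = indicator (box A) x *\<^sub>R c"
      by (intro average_box_AE) auto
    moreover have [measurable]: "average (cells D) (\<lambda>x. indicator (box A) x *\<^sub>R c) \<in> borel_measurable \<Omega>"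
      using D by (intro measurable_average finite_partition_cells_sides) auto
    ultimately have "fnorm (\<lambda>x. indicator (box A) x *\<^sub>R c - average (cells D) (\<lambda>x. indicator (box A) x *\<^sub>R c) x) = 0"
      by (subst fnorm_eq_0_iff) auto
    then show "fnorm (\<lambda>x. indicator (box A) x *\<^sub>R c - average (cells D) (\<lambda>x. indicator (box A) x *\<^sub>R c) x) < ennreal e"
      using \<open>0 < e\<close> by simp
  qed simp
qed

text \<open>The intersection with a fixed box of sides of finite measure is what makes the Dynkin
  argument possible: complements are taken relative to \<open>box E\<close>, and its indicator
  dominates the partial unions.\<close>

lemma approximable_indicator:
  assumes E: "\<And>i. i \<in> {1..n} \<Longrightarrow> E i \<in> sets (M i)" "\<And>i. i \<in> {1..n} \<Longrightarrow> emeasure (M i) (E i) \<noteq> top"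
    and A: "A \<in> sets \<Omega>"
  shows "approximable (\<lambda>x. indicator (A \<inter> box E) x *\<^sub>R c)"
proof -
  have E_sets [measurable]: "box E \<in> sets \<Omega>" using E by (intro sets_PiM_I_finite) auto
  from A have "A \<in> sigma_sets (\<Pi>\<^sub>E i\<in>{1..n}. space (M i)) (prod_algebra {1..n} M)"
    by (simp add: sets_PiM)
  with Int_stable_prod_algebra prod_algebra_sets_into_space show ?thesis
  proof (induction rule: sigma_sets_induct_disjoint)
    case (basic A)
    then obtain X where "A = box X" "X \<in> (\<Pi> i\<in>{1..n}. sets (M i))"
      by (auto simp: prod_algebra_eq_finite)
    then have X: "A = box X" "\<And>i. i \<in> {1..n} \<Longrightarrow> X i \<in> sets (M i)" by auto
    have "approximable (\<lambda>x. indicator (box (\<lambda>i. X i \<inter> E i)) x *\<^sub>R c)"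
    proof (rule approximable_box)
      fix i assume i: "i \<in> {1..n}"
      then have "emeasure (M i) (X i \<inter> E i) \<le> emeasure (M i) (E i)" using E by (intro emeasure_mono) auto
      then show "emeasure (M i) (X i \<inter> E i) \<noteq> top" using E(2)[OF i] by (auto simp: top_unique)
      show "X i \<inter> E i \<in> sets (M i)" using X E i by auto
    qed
    then show ?case by (simp add: X PiE_Int)
  next
    case empty
    then show ?case by (simp add: approximable_0)
  next
    case (compl A)
    have "approximable (\<lambda>x. indicator (box E) x *\<^sub>R c + - (indicator (A \<inter> box E) x *\<^sub>R c))"
      by (intro approximable_add approximable_uminus approximable_box E compl)
    moreover have "(\<lambda>x. indicator (box E) x *\<^sub>R c + - (indicator (A \<inter> box E) x *\<^sub>R c)) =
        (\<lambda>x. indicator (((\<Pi>\<^sub>E i\<in>{1..n}. space (M i)) - A) \<inter> box E) x *\<^sub>R c)"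
      using sets.sets_into_space[OF E_sets] by (auto simp: space_PiM indicator_def fun_eq_iff)
    ultimately show ?case by simp
  next
    case (union A)
    have [measurable]: "A i \<in> sets \<Omega>" for i using union(2) by (auto simp: sets_PiM)
    \<comment> \<open>By disjointness the indicator of a finite union is a sum of indicators; the
      countable union is a dominated limit of these.\<close>
    have F: "approximable (\<lambda>x. indicator ((\<Union>j<m. A j) \<inter> box E) x *\<^sub>R c)" for m
    proof (induction m)
      case (Suc m)
      have "A m \<inter> A j = {}" if "j < m" for j
        using disjoint_family_onD[OF \<open>disjoint_family A\<close>, of m j] that by simp
      then have "(\<lambda>x. indicator ((\<Union>j<Suc m. A j) \<inter> box E) x *\<^sub>R c) =
          (\<lambda>x. indicator ((\<Union>j<m. A j) \<inter> box E) x *\<^sub>R c + indicator (A m \<inter> box E) x *\<^sub>R c)"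
        by (fastforce simp: indicator_def fun_eq_iff lessThan_Suc)
      then show ?case using approximable_add[OF Suc union(3)] by simp
    qed (simp add: approximable_0)
    show ?case
    proof (rule approximable_dominated_limit[OF F])
      show "total_norm (\<lambda>x. ennreal (norm (indicator (box E) x *\<^sub>R c))) < top"
        using Lp_box[of E c] E by (simp add: Lp_def fnorm_def)
      show "(\<lambda>m. indicator ((\<Union>j<m. A j) \<inter> box E) x *\<^sub>R c) \<longlonglongrightarrow> indicator (\<Union> (range A) \<inter> box E) x *\<^sub>R c" for x
        using LIMSEQ_indicator_UN[of A x] unfolding indicator_inter_arith by (intro tendsto_intros)
      show "ennreal (norm (indicator ((\<Union>j<m. A j) \<inter> box E) x *\<^sub>R c)) \<le> ennreal (norm (indicator (box E) x *\<^sub>R c))" for m x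
        by (simp add: indicator_def)
    qed measurable
  qed
qed

text \<open>Simple functions tending to \<open>f\<close> and bounded by
  \<open>2 * norm (f x)\<close> are cut off to boxes of finite measure that exhaust the space. Each
  is a finite sum of indicators times values, and \<open>2 * norm (f x)\<close> dominates them
  all.\<close>

lemma approximable_iff_Lp:
  fixes f :: "(nat \<Rightarrow> 'a) \<Rightarrow> 'b::{banach, second_countable_topology}"
  shows "approximable f \<longleftrightarrow> f \<in> Lp"
proof
  assume f: "f \<in> Lp"
  note [measurable] = Lp_measurable[OF f]
  interpret finite_product_sigma_finite M "{1..n}" by standard simp
  obtain E :: "nat \<Rightarrow> nat \<Rightarrow> 'a set" where E: "\<forall>i\<in>{1..n}. range (E i) \<subseteq> sets (M i)"
    "\<forall>k. \<forall>i\<in>{1..n}. emeasure (M i) (E i k) \<noteq> \<infinity>"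
    "incseq (\<lambda>k. \<Pi>\<^sub>E i\<in>{1..n}. E i k)" "(\<Union>k. \<Pi>\<^sub>E i\<in>{1..n}. E i k) = space \<Omega>"
    using sigma_finite_pairs by (elim exE conjE) (rule that)
  have E_sets: "E i m \<in> sets (M i)" if "i \<in> {1..n}" for i m using E(1) that by blast
  obtain s where s: "\<And>m. simple_function \<Omega> (s m)" "\<And>x. x \<in> space \<Omega> \<Longrightarrow> (\<lambda>m. s m x) \<longlonglongrightarrow> f x"
    "\<And>m x. x \<in> space \<Omega> \<Longrightarrow> norm (s m x) \<le> 2 * norm (f x)"
    using borel_measurable_implies_sequence_metric[OF Lp_measurable[OF f], of 0] unfolding dist_0_norm dist_norm diff_zero by blast
  let ?F = "\<lambda>m x. \<Sum>y\<in>s m ` space \<Omega>. indicator ((s m -` {y} \<inter> space \<Omega>) \<inter> box (\<lambda>i. E i m)) x *\<^sub>R y"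
  have F: "?F m x = indicator (box (\<lambda>i. E i m)) x *\<^sub>R s m x" if "x \<in> space \<Omega>" for m x
  proof -
    have "?F m x = (\<Sum>y\<in>s m ` space \<Omega>. if y = s m x then indicator (box (\<lambda>i. E i m)) x *\<^sub>R s m x else 0)"
      using that by (intro sum.cong) (auto simp: indicator_def)
    also have "\<dots> = indicator (box (\<lambda>i. E i m)) x *\<^sub>R s m x"
      using that simple_functionD(1)[OF s(1)] by simp
    finally show ?thesis .
  qed
  show "approximable f"
  proof (rule approximable_dominated_limit[of ?F])
    show "approximable (?F m)" for m
      using E(2) E_sets simple_functionD(2)[OF s(1)] by (intro approximable_sum approximable_indicator) auto
    show "total_norm (\<lambda>x. 2 * ennreal (norm (f x))) < top"
      using f by (simp add: total_norm_cmult Lp_def fnorm_def ennreal_mult_less_top)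
    show "ennreal (norm (?F m x)) \<le> 2 * ennreal (norm (f x))" if "x \<in> space \<Omega>" for m x
    proof -
      have "norm (?F m x) \<le> 2 * norm (f x)"
        using s(3)[OF that, of m] unfolding F[OF that] by (auto simp: indicator_def)
      then have "ennreal (norm (?F m x)) \<le> ennreal (2 * norm (f x))" by (rule ennreal_leI)
      then show ?thesis by (simp add: ennreal_mult)
    qed
    show "(\<lambda>m. ?F m x) \<longlonglongrightarrow> f x" if "x \<in> space \<Omega>" for x
      unfolding F[OF that] using that E s(2) by (intro LIMSEQ_scaleR_indicator) auto
  qed measurable
qed (rule approximable_Lp)

text \<open>Finitely many eventual statements hold together eventually, and the filter is proper, so
  a common family exists.\<close>

lemma ex_average_approximation:
  fixes S :: "((nat \<Rightarrow> 'a) \<Rightarrow> 'b::{banach, second_countable_topology}) set"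
  assumes "finite S" "S \<subseteq> Lp" "0 < e"
  shows "\<exists>P. finite_partition P \<and> (\<forall>f\<in>S. fnorm (\<lambda>x. f x - average P f x) < ennreal e)"
proof -
  have "eventually (\<lambda>D. \<forall>f\<in>S. fnorm (\<lambda>x. f x - average (cells D) f x) < ennreal e) (finite_subsets_at_top finite_sides)"
    using assms approximable_iff_Lp by (intro eventually_ball_finite) (auto simp: approximable_def)
  then have "eventually (\<lambda>D. finite_partition (cells D) \<and>
      (\<forall>f\<in>S. fnorm (\<lambda>x. f x - average (cells D) f x) < ennreal e)) (finite_subsets_at_top finite_sides)"
    using eventually_finite_sides by eventually_elim auto
  then show ?thesis using eventually_happens'[OF finite_subsets_at_top_neq_bot] by blast
qed

end

section \<open>The weighted space\<close>

locale weighted_mixed_exponents = mixed_exponents M n p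
  for M :: "nat \<Rightarrow> 'a measure" and n :: nat and p :: "nat \<Rightarrow> real" +
  fixes w :: "(nat \<Rightarrow> 'a) \<Rightarrow> real"
  assumes n_ge_1: "1 \<le> n"
    and w_measurable [measurable]: "w \<in> borel_measurable \<Omega>"
    and w_pos: "\<And>x. x \<in> space \<Omega> \<Longrightarrow> 0 < w x"
begin

text \<open>The weight enters only the innermost integrand, with power \<open>p 1\<close>; hence the
  root of that order, whatever the other exponents are.\<close>

definition \<omega> :: "(nat \<Rightarrow> 'a) \<Rightarrow> real" where
  "\<omega> x = w x powr (1 / p 1)"

definition weighted :: "((nat \<Rightarrow> 'a) \<Rightarrow> 'b::real_vector) \<Rightarrow> (nat \<Rightarrow> 'a) \<Rightarrow> 'b" where
  "weighted f x = \<omega> x *\<^sub>R f x"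

lemma \<omega>_measurable [measurable]: "\<omega> \<in> borel_measurable \<Omega>"
  unfolding \<omega>_def by measurable

lemma \<omega>_pos: "x \<in> space \<Omega> \<Longrightarrow> 0 < \<omega> x"
  using w_pos by (simp add: \<omega>_def less_imp_neq[symmetric])

lemma weighted_measurable [measurable]:
  "f \<in> borel_measurable \<Omega> \<Longrightarrow> weighted f \<in> borel_measurable (\<Omega> :: (nat \<Rightarrow> 'a) measure)"
  for f :: "(nat \<Rightarrow> 'a) \<Rightarrow> 'b::{real_normed_vector, second_countable_topology}"
  unfolding weighted_def by measurable

text \<open>The mixed integral lacks the root of its last level, which accounts for the power
  \<open>p (Suc k)\<close>. The point is confined to the product space because the weight is known
  to be positive only there.\<close>

lemma mixed_integral_eq_iterated_norm:
  assumes "Suc k \<le> n" "x \<in> space (tail_space (Suc k))"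
  shows "mixed_integral M p w f (Suc k) x =
    ennreal_powr (N (Suc k) (\<lambda>x. ennreal (norm (weighted f x))) x) (p (Suc k))"
  using assms
proof (induction k arbitrary: x)
  case 0
  have "mixed_integral M p w f (Suc 0) x = (\<integral>\<^sup>+t. ennreal_powr (ennreal (norm (weighted f (x(1 := t))))) (p 1) \<partial>M 1)"
    unfolding mixed_integral.simps
  proof (rule nn_integral_cong)
    fix t assume "t \<in> space (M 1)"
    then have "x(1 := t) \<in> space \<Omega>"
      using 0 update_in_tail[of 0 x t] unfolding One_nat_def by simp
    then show "ennreal (norm (f (x(1 := t))) powr p 1 * w (x(1 := t))) =
        ennreal_powr (ennreal (norm (weighted f (x(1 := t))))) (p 1)"
      using w_pos[of "x(1 := t)"] p_ge_1[of 1] n_ge_1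
      by (simp add: ennreal_powr_ennreal weighted_def \<omega>_def powr_mult powr_powr mult.commute)
  qed
  then show ?case
    using p_Suc_pos[of 0] 0 by (simp add: One_nat_def lp_norm_def ennreal_powr_inverse)
next
  case (Suc k)
  let ?g = "\<lambda>x. ennreal (norm (weighted f x))"
  have "mixed_integral M p w f (Suc (Suc k)) x =
      (\<integral>\<^sup>+t. ennreal_powr (N (Suc k) ?g (x(Suc (Suc k) := t))) (p (Suc (Suc k))) \<partial>M (Suc (Suc k)))"
    unfolding mixed_integral.simps(3)
  proof (rule nn_integral_cong)
    fix t assume "t \<in> space (M (Suc (Suc k)))"
    then have "x(Suc (Suc k) := t) \<in> space (tail_space (Suc k))"
      using Suc.prems by (intro update_in_tail) auto
    moreover have "0 < p (Suc k)" "0 < p (Suc (Suc k))"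
      using Suc.prems by (auto intro!: p_Suc_pos)
    ultimately show "ennreal_powr (mixed_integral M p w f (Suc k) (x(Suc (Suc k) := t))) (p (Suc (Suc k)) / p (Suc k)) =
        ennreal_powr (N (Suc k) ?g (x(Suc (Suc k) := t))) (p (Suc (Suc k)))"
      using Suc by (simp del: iterated_norm.simps mixed_integral.simps add: ennreal_powr_powr)
  qed
  moreover have "0 < p (Suc (Suc k))"
    using Suc.prems by (auto intro!: p_Suc_pos)
  ultimately show ?case
    unfolding iterated_norm.simps(2)[of _ _ _ "Suc k"] lp_norm_def by (simp only: ennreal_powr_inverse)
qed

lemma mixed_norm_eq_fnorm: "mixed_norm n M p w f = fnorm (weighted f)"
proof -
  obtain k where k: "n = Suc k" using n_ge_1 by (cases n) auto
  have "0 < p n" using p_ge_1[of n] n_ge_1 by simp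
  then show ?thesis
    using mixed_integral_eq_iterated_norm[of k "\<lambda>_. undefined" f] undefined_in_tail
    unfolding k[symmetric] by (simp add: mixed_norm_def fnorm_def total_norm_def ennreal_powr_inverse)
qed

abbreviation L :: "((nat \<Rightarrow> 'a) \<Rightarrow> 'k::{real_normed_field, banach, second_countable_topology}) set" where
  "L \<equiv> mixed_lp_functions n M p w"

lemma mem_L_iff: "f \<in> L \<longleftrightarrow> f \<in> borel_measurable \<Omega> \<and> weighted f \<in> Lp"
  by (auto simp: mixed_lp_functions_def mixed_norm_eq_fnorm Lp_def)

lemma L_measurable [measurable_dest]: "f \<in> L \<Longrightarrow> f \<in> borel_measurable \<Omega>"
  by (simp add: mem_L_iff)

lemma weighted_Lp: "f \<in> L \<Longrightarrow> weighted f \<in> Lp"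
  by (simp add: mem_L_iff)

lemma weighted_add: "weighted (\<lambda>x. f x + g x) = (\<lambda>x. weighted f x + weighted g x)"
  and weighted_diff: "weighted (\<lambda>x. f x - g x) = (\<lambda>x. weighted f x - weighted g x)"
  by (auto simp: weighted_def scaleR_add_right scaleR_diff_right)

lemma weighted_cmult: "weighted (\<lambda>x. c * f x) = (\<lambda>x. c * weighted f x)"
  for c :: "'k::real_normed_field"
  by (auto simp: weighted_def)

lemma L_add: "f \<in> L \<Longrightarrow> g \<in> L \<Longrightarrow> (\<lambda>x. f x + g x) \<in> L"
  by (auto simp: mem_L_iff weighted_add Lp_add)

lemma L_diff: "f \<in> L \<Longrightarrow> g \<in> L \<Longrightarrow> (\<lambda>x. f x - g x) \<in> L"
  by (auto simp: mem_L_iff weighted_diff Lp_diff)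

lemma L_cmult: "f \<in> L \<Longrightarrow> (\<lambda>x. c * f x) \<in> L"
  by (auto simp: mem_L_iff weighted_cmult Lp_cmult)

lemma L_0: "(\<lambda>_. 0 :: 'k::{real_normed_field, banach, second_countable_topology}) \<in> L"
proof -
  have "weighted (\<lambda>_. 0 :: 'k) = (\<lambda>_. 0)" by (auto simp: weighted_def)
  then show ?thesis using approximable_0[THEN approximable_Lp] by (simp add: mem_L_iff)
qed

lemma weighted_eq_iff: "x \<in> space \<Omega> \<Longrightarrow> weighted f x = weighted g x \<longleftrightarrow> f x = g x"
  using \<omega>_pos[of x] by (simp add: weighted_def)

lemma AE_weighted_eq_iff: "(AE x in \<Omega>. weighted f x = weighted g x) \<longleftrightarrow> (AE x in \<Omega>. f x = g x)"
  by (intro AE_cong weighted_eq_iff)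

definition rnorm :: "((nat \<Rightarrow> 'a) \<Rightarrow> 'k::{real_normed_field, banach, second_countable_topology}) \<Rightarrow> real" where
  "rnorm f = enn2real (fnorm (weighted f))"

lemma fnorm_eq_rnorm: "f \<in> L \<Longrightarrow> fnorm (weighted f) = ennreal (rnorm f)"
  by (simp add: rnorm_def mem_L_iff Lp_def)

lemma rnorm_nonneg: "0 \<le> rnorm f"
  by (simp add: rnorm_def)

lemma rnorm_less_iff: "f \<in> L \<Longrightarrow> rnorm f < e \<longleftrightarrow> fnorm (weighted f) < ennreal e"
  by (simp add: fnorm_eq_rnorm ennreal_less_iff rnorm_nonneg)

lemma rnorm_add_le:
  assumes "f \<in> L" "g \<in> L"
  shows "rnorm (\<lambda>x. f x + g x) \<le> rnorm f + rnorm g"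
proof -
  have "ennreal (rnorm (\<lambda>x. f x + g x)) \<le> ennreal (rnorm f) + ennreal (rnorm g)"
    using fnorm_add_le[of "weighted f" "weighted g"] assms
    by (simp add: fnorm_eq_rnorm[symmetric] L_add weighted_add weighted_Lp Lp_measurable)
  then show ?thesis by (simp add: rnorm_nonneg flip: ennreal_plus)
qed

lemma rnorm_cong_AE:
  assumes "f \<in> L" "g \<in> L" "AE x in \<Omega>. f x = g x"
  shows "rnorm f = rnorm g"
  using fnorm_cong_AE[of "weighted f" "weighted g"] assms
  by (simp add: rnorm_def AE_weighted_eq_iff weighted_Lp Lp_measurable)

lemma rnorm_eq_0_iff:
  assumes "f \<in> L"
  shows "rnorm f = 0 \<longleftrightarrow> (AE x in \<Omega>. f x = 0)"
proof -
  have "rnorm f = 0 \<longleftrightarrow> fnorm (weighted f) = 0"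
    using assms by (simp add: fnorm_eq_rnorm rnorm_nonneg)
  also have "\<dots> \<longleftrightarrow> (AE x in \<Omega>. weighted f x = 0)"
    using assms by (intro fnorm_eq_0_iff) (simp add: weighted_Lp Lp_measurable)
  also have "\<dots> \<longleftrightarrow> (AE x in \<Omega>. f x = 0)"
    using \<omega>_pos by (intro AE_cong) (force simp: weighted_def)
  finally show ?thesis .
qed

text \<open>The averaging operator conjugated by the isometry \<open>weighted\<close>.\<close>

definition weighted_average ::
    "(nat \<Rightarrow> 'a set set) \<Rightarrow> ((nat \<Rightarrow> 'a) \<Rightarrow> 'k::{real_normed_field, banach, second_countable_topology}) \<Rightarrow> (nat \<Rightarrow> 'a) \<Rightarrow> 'k" where
  "weighted_average P f x = inverse (\<omega> x) *\<^sub>R average P (weighted f) x"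

lemma weighted_weighted_average:
  "x \<in> space \<Omega> \<Longrightarrow> weighted (weighted_average P f) x = average P (weighted f) x"
  using \<omega>_pos[of x] by (simp add: weighted_def weighted_average_def)

lemma weighted_average_L:
  assumes P: "finite_partition P" and f: "f \<in> L"
  shows "weighted_average P f \<in> L"
proof -
  note [measurable] = measurable_average[OF P, of "weighted f"]
  have [measurable]: "weighted_average P f \<in> borel_measurable \<Omega>"
    unfolding weighted_average_def by measurable
  have "fnorm (weighted (weighted_average P f)) = fnorm (average P (weighted f))"
    by (intro fnorm_cong) (simp add: weighted_weighted_average)
  also have "\<dots> < top"
    using average_Lp[OF P weighted_Lp[OF f]] by (simp add: Lp_def)
  finally show ?thesis by (simp add: mem_L_iff Lp_def)
qed

lemma rnorm_weighted_average_le: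
  assumes P: "finite_partition P" and f: "f \<in> L"
  shows "rnorm (weighted_average P f) \<le> rnorm f"
proof -
  have "ennreal (rnorm (weighted_average P f)) = fnorm (average P (weighted f))"
    unfolding fnorm_eq_rnorm[OF weighted_average_L[OF P f], symmetric]
    by (intro fnorm_cong) (simp add: weighted_weighted_average)
  also have "\<dots> \<le> fnorm (weighted f)"
    by (intro fnorm_average_le P Lp_measurable weighted_Lp f)
  also have "\<dots> = ennreal (rnorm f)" by (rule fnorm_eq_rnorm[OF f])
  finally show ?thesis by (simp add: rnorm_nonneg)
qed

lemma weighted_average_add:
  assumes "finite_partition P" "f \<in> L" "g \<in> L"
  shows "weighted_average P (\<lambda>x. f x + g x) = (\<lambda>x. weighted_average P f x + weighted_average P g x)"
  unfolding weighted_average_def weighted_add using assms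
  by (simp add: average_add weighted_Lp scaleR_add_right)

lemma weighted_average_cmult:
  "weighted_average P (\<lambda>x. c * f x) = (\<lambda>x. c * weighted_average P f x)"
  unfolding weighted_average_def weighted_cmult by (simp add: average_cmult)

lemma weighted_average_cong_AE:
  assumes "finite_partition P" "f \<in> L" "g \<in> L" "AE x in \<Omega>. f x = g x"
  shows "weighted_average P f = weighted_average P g"
  unfolding weighted_average_def using assms
  by (subst average_cong_AE[of P "weighted f" "weighted g"]) (auto simp: AE_weighted_eq_iff weighted_Lp Lp_measurable)

lemma weighted_average_error:
  "x \<in> space \<Omega> \<Longrightarrow> weighted (\<lambda>x. f x - weighted_average P f x) x = weighted f x - average P (weighted f) x"
  by (simp add: weighted_diff weighted_weighted_average)

text \<open>The preimages of the box indicators under the isometry; their classes span a space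
  containing the range of the averaging operator.\<close>

definition weighted_box :: "(nat \<Rightarrow> 'a set) \<Rightarrow> (nat \<Rightarrow> 'a) \<Rightarrow> 'k::{real_normed_field, banach, second_countable_topology}" where
  "weighted_box b x = of_real (indicator (box b) x * inverse (\<omega> x))"

lemma weighted_box_L:
  assumes P: "finite_partition P" and b: "b \<in> Pi\<^sub>E {1..n} P"
  shows "(weighted_box b :: _ \<Rightarrow> 'k::{real_normed_field, banach, second_countable_topology}) \<in> L"
proof -
  note [measurable] = box_sets[OF P b]
  have [measurable]: "(weighted_box b :: _ \<Rightarrow> 'k) \<in> borel_measurable \<Omega>"
    unfolding weighted_box_def by measurable
  have "fnorm (weighted (weighted_box b :: _ \<Rightarrow> 'k)) = fnorm (\<lambda>x. indicator (box b) x *\<^sub>R (1::'k))"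
    using \<omega>_pos by (intro fnorm_cong) (force simp: weighted_def weighted_box_def scaleR_conv_of_real indicator_def)
  also have "\<dots> < top"
    using Lp_box[of b "1::'k"] finite_partitionD[OF P] b by (auto simp: Lp_def PiE_iff)
  finally show ?thesis by (simp add: mem_L_iff Lp_def)
qed

lemma weighted_average_eq_sum:
  "weighted_average P f = (\<lambda>x. \<Sum>b\<in>Pi\<^sub>E {1..n} P.
     (inverse (measure \<Omega> (box b)) *\<^sub>R set_lebesgue_integral \<Omega> (box b) (weighted f)) * weighted_box b x)"
  by (auto simp: weighted_average_def average_def weighted_box_def scaleR_sum_right scaleR_conv_of_real
      sum_distrib_left fun_eq_iff mult_ac intro!: sum.cong)

section \<open>Classes modulo null sets\<close>

abbreviation R :: "(((nat \<Rightarrow> 'a) \<Rightarrow> 'k::{real_normed_field, banach, second_countable_topology}) \<times> ((nat \<Rightarrow> 'a) \<Rightarrow> 'k)) set" where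
  "R \<equiv> mixed_lp_rel n M p w"

abbreviation cls :: "((nat \<Rightarrow> 'a) \<Rightarrow> 'k::{real_normed_field, banach, second_countable_topology}) \<Rightarrow> ((nat \<Rightarrow> 'a) \<Rightarrow> 'k) set" where
  "cls f \<equiv> R `` {f}"

abbreviation B :: "('k::{real_normed_field, banach, second_countable_topology}, ((nat \<Rightarrow> 'a) \<Rightarrow> 'k) set) normed_structure" where
  "B \<equiv> mixed_lp_space n M p w"

lemma equiv_R: "equiv (L :: ((nat \<Rightarrow> 'a) \<Rightarrow> 'k::{real_normed_field, banach, second_countable_topology}) set) R"
proof (rule equivI)
  show "(R :: (_ \<times> ((nat \<Rightarrow> 'a) \<Rightarrow> 'k)) set) \<subseteq> L \<times> L" by (auto simp: mixed_lp_rel_def)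
  show "refl_on L (R :: (_ \<times> ((nat \<Rightarrow> 'a) \<Rightarrow> 'k)) set)" by (auto simp: refl_on_def mixed_lp_rel_def)
  show "sym (R :: (_ \<times> ((nat \<Rightarrow> 'a) \<Rightarrow> 'k)) set)" by (auto simp: sym_def mixed_lp_rel_def elim: eventually_mono)
  show "trans (R :: (_ \<times> ((nat \<Rightarrow> 'a) \<Rightarrow> 'k)) set)"
  proof (rule transI)
    fix f g h :: "(nat \<Rightarrow> 'a) \<Rightarrow> 'k" assume "(f, g) \<in> R" "(g, h) \<in> R"
    moreover from this have "AE x in \<Omega>. f x = h x"
      unfolding mixed_lp_rel_def by (auto elim: AE_mp)
    ultimately show "(f, h) \<in> R" by (auto simp: mixed_lp_rel_def)
  qed
qed

lemma R_iff: "(f, g) \<in> R \<longleftrightarrow> f \<in> L \<and> g \<in> L \<and> (AE x in \<Omega>. f x = g x)"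
  by (simp add: mixed_lp_rel_def)

lemma cls_eq_iff: "f \<in> L \<Longrightarrow> g \<in> L \<Longrightarrow> cls f = cls g \<longleftrightarrow> (AE x in \<Omega>. f x = g x)"
  using eq_equiv_class_iff[OF equiv_R] by (auto simp: R_iff)

lemma cls_cong: "f \<in> L \<Longrightarrow> g \<in> L \<Longrightarrow> (AE x in \<Omega>. f x = g x) \<Longrightarrow> cls f = cls g"
  by (simp add: cls_eq_iff)

lemma cls_self: "f \<in> L \<Longrightarrow> f \<in> cls f"
  by (simp add: R_iff)

lemma vcarrier_B: "vcarrier B = cls ` L"
  by (auto simp: mixed_lp_space_def Let_def quotient_def)

lemma vcarrierE:
  assumes "X \<in> vcarrier B"
  obtains f where "f \<in> L" "X = cls f"
  using assms by (auto simp: vcarrier_B)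

lemma cls_in_vcarrier: "f \<in> L \<Longrightarrow> cls f \<in> vcarrier B"
  by (simp add: vcarrier_B)

lemma vadd_cls:
  assumes f: "f \<in> L" and g: "g \<in> L"
  shows "vadd B (cls f) (cls g) = cls (\<lambda>x. f x + g x)"
proof -
  have eq: "cls (\<lambda>x. f' x + g' x) = cls (\<lambda>x. f x + g x)" if "f' \<in> cls f" "g' \<in> cls g" for f' g'
  proof (rule cls_cong)
    have *: "f' \<in> L" "g' \<in> L" "AE x in \<Omega>. f x = f' x" "AE x in \<Omega>. g x = g' x"
      using that by (auto simp: R_iff)
    then show "(\<lambda>x. f' x + g' x) \<in> L" by (intro L_add)
    show "AE x in \<Omega>. f' x + g' x = f x + g x" using *(3,4) by eventually_elim simp
  qed (intro L_add f g)
  have "(\<Union>f'\<in>cls f. \<Union>g'\<in>cls g. cls (\<lambda>x. f' x + g' x)) = (\<Union>f'\<in>cls f. \<Union>g'\<in>cls g. cls (\<lambda>x. f x + g x))"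
    by (intro SUP_cong refl eq)
  also have "\<dots> = cls (\<lambda>x. f x + g x)" using cls_self[OF f] cls_self[OF g] by blast
  finally show ?thesis by (simp add: mixed_lp_space_def Let_def)
qed

lemma vscale_cls:
  assumes f: "f \<in> L"
  shows "vscale B c (cls f) = cls (\<lambda>x. c * f x)"
proof -
  have eq: "cls (\<lambda>x. c * f' x) = cls (\<lambda>x. c * f x)" if "f' \<in> cls f" for f'
  proof (rule cls_cong)
    have *: "f' \<in> L" "AE x in \<Omega>. f x = f' x" using that by (auto simp: R_iff)
    then show "(\<lambda>x. c * f' x) \<in> L" by (intro L_cmult)
    show "AE x in \<Omega>. c * f' x = c * f x" using *(2) by eventually_elim simp
  qed (intro L_cmult f)
  have "(\<Union>f'\<in>cls f. cls (\<lambda>x. c * f' x)) = (\<Union>f'\<in>cls f. cls (\<lambda>x. c * f x))"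
    by (intro SUP_cong refl eq)
  also have "\<dots> = cls (\<lambda>x. c * f x)" using cls_self[OF f] by blast
  finally show ?thesis by (simp add: mixed_lp_space_def Let_def)
qed

lemma vzero_B: "vzero B = cls (\<lambda>_. 0)"
  by (simp add: mixed_lp_space_def Let_def)

text \<open>All representatives of a class have the same norm, so \<open>the_elem\<close> is applied
  to a singleton.\<close>

lemma vnorm_cls:
  assumes f: "f \<in> L"
  shows "vnorm B (cls f) = rnorm f"
proof -
  have "enn2real (mixed_norm n M p w f') = rnorm f" if "f' \<in> cls f" for f'
    using that rnorm_cong_AE[of f f'] by (simp add: R_iff mixed_norm_eq_fnorm rnorm_def)
  then have "(\<lambda>f. enn2real (mixed_norm n M p w f)) ` cls f = {rnorm f}"
    using cls_self[OF f] by (intro equalityI subsetI) (auto simp del: Image_singleton_iff intro: image_eqI[where x = f])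
  then show ?thesis by (simp add: mixed_lp_space_def Let_def)
qed

lemma vdiff_cls:
  assumes "f \<in> L" "g \<in> L"
  shows "vdiff B (cls f) (cls g) = cls (\<lambda>x. f x - g x)"
  using assms L_cmult[of g "-1"] by (simp add: vdiff_def vscale_cls vadd_cls)

lemma vdist_cls:
  assumes "f \<in> L" "g \<in> L"
  shows "vdist B (cls f) (cls g) = rnorm (\<lambda>x. f x - g x)"
  using assms by (simp add: vdist_def cls_in_vcarrier vdiff_cls vnorm_cls L_diff)

lemma rnorm_minus_commute: "rnorm (\<lambda>x. f x - g x) = rnorm (\<lambda>x. g x - f x)"
  unfolding rnorm_def weighted_diff by (subst fnorm_minus_commute) simp

lemma Metric_space_B:
  "Metric_space (vcarrier (B :: ('k::{real_normed_field, banach, second_countable_topology}, ((nat \<Rightarrow> 'a) \<Rightarrow> 'k) set) normed_structure)) (vdist B)"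
  (is "Metric_space (vcarrier ?B) (vdist ?B)")
proof
  show "0 \<le> vdist ?B X Y" for X Y
  proof (cases "X \<in> vcarrier ?B \<and> Y \<in> vcarrier ?B")
    case True
    then show ?thesis by (auto elim!: vcarrierE simp: vdist_cls rnorm_nonneg)
  next
    case False
    then show ?thesis by (simp only: vdist_def if_False order_refl)
  qed
  show "vdist ?B X Y = vdist ?B Y X" for X Y
  proof (cases "X \<in> vcarrier ?B \<and> Y \<in> vcarrier ?B")
    case True
    then show ?thesis
      by (elim conjE vcarrierE) (simp only: vdist_cls, rule rnorm_minus_commute)
  next
    case False
    then have "\<not> (Y \<in> vcarrier ?B \<and> X \<in> vcarrier ?B)" by blast
    with False show ?thesis by (simp only: vdist_def if_False)
  qed
  fix X Y assume "X \<in> vcarrier ?B" "Y \<in> vcarrier ?B"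
  then obtain f g where fg: "f \<in> L" "g \<in> L" "X = cls f" "Y = cls g" by (elim vcarrierE)
  have "vdist ?B X Y = 0 \<longleftrightarrow> (AE x in \<Omega>. f x - g x = 0)"
    using fg by (simp add: vdist_cls rnorm_eq_0_iff L_diff)
  then show "vdist ?B X Y = 0 \<longleftrightarrow> X = Y" using fg by (simp add: cls_eq_iff)
  fix Z assume "Z \<in> vcarrier ?B"
  then obtain h where h: "h \<in> L" "Z = cls h" by (elim vcarrierE)
  show "vdist ?B X Z \<le> vdist ?B X Y + vdist ?B Y Z"
    using fg h rnorm_add_le[of "\<lambda>x. f x - g x" "\<lambda>x. g x - h x"] by (simp add: vdist_cls L_diff)
qed

text \<open>The span is an intersection, so membership is shown in every subspace \<open>V\<close>
  containing the generators. Membership of the partial sums in \<open>L\<close> is carried along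
  because the formula for adding classes requires it.\<close>

lemma cls_sum_in_vspan:
  assumes S: "\<And>i. i \<in> I \<Longrightarrow> f i \<in> L"
  shows "cls (\<lambda>x. \<Sum>i\<in>I. c i * f i x) \<in> vspan B ((\<lambda>i. cls (f i)) ` I)"
proof -
  have "cls (\<lambda>x. \<Sum>i\<in>J. c i * f i x) \<in> V \<and> (\<lambda>x. \<Sum>i\<in>J. c i * f i x) \<in> L"
    if V: "vsubspace B V" "(\<lambda>i. cls (f i)) ` I \<subseteq> V" and "J \<subseteq> I" for V J
    using \<open>J \<subseteq> I\<close>
  proof (induction J rule: infinite_finite_induct)
    case (insert i J)
    have i: "f i \<in> L" "cls (f i) \<in> V" using insert.prems S V by auto
    then have "vscale B (c i) (cls (f i)) \<in> V" using V(1) by (simp add: vsubspace_def)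
    then have "cls (\<lambda>x. c i * f i x) \<in> V" using i by (simp add: vscale_cls)
    moreover have "cls (\<lambda>x. \<Sum>i\<in>J. c i * f i x) \<in> V" "(\<lambda>x. \<Sum>i\<in>J. c i * f i x) \<in> L"
      using insert by auto
    ultimately have "vadd B (cls (\<lambda>x. c i * f i x)) (cls (\<lambda>x. \<Sum>i\<in>J. c i * f i x)) \<in> V"
      using V(1) by (simp add: vsubspace_def)
    with i insert show ?case by (simp add: vadd_cls L_cmult L_add)
  qed (use V(1) in \<open>auto simp: vsubspace_def vzero_B[symmetric] L_0\<close>)
  then show ?thesis unfolding vspan_def hull_def by blast
qed

section \<open>Approximation on compact sets\<close>

lemma metric_approximation_property_B:
  "metric_approximation_property (B :: ('k::{real_normed_field, banach, second_countable_topology}, ((nat \<Rightarrow> 'a) \<Rightarrow> 'k) set) normed_structure)"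
  (is "metric_approximation_property ?B")
  unfolding metric_approximation_property_def
proof (intro allI impI)
  fix K :: "((nat \<Rightarrow> 'a) \<Rightarrow> 'k) set set" and \<epsilon> :: real
  assume *: "compactin (vtopology ?B) K \<and> 0 < \<epsilon>"
  interpret B: Metric_space "vcarrier ?B" "vdist ?B" by (rule Metric_space_B)
  have "B.mtotally_bounded K" using * by (intro B.compactin_imp_mtotally_bounded) auto
  \<comment> \<open>The thirds match the three terms of \<open>fnorm_average_error_le\<close>: twice
    the distance to a centre of the net, once the error at that centre.\<close>
  then obtain S where S: "finite S" "S \<subseteq> K" "K \<subseteq> (\<Union>X\<in>S. B.mball X (\<epsilon> / 3))"
    unfolding B.mtotally_bounded_def using * by (meson divide_pos_pos zero_less_numeral)
  have K: "K \<subseteq> vcarrier ?B" using * compactin_subset_topspace by fastforce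
  \<comment> \<open>The choice of representatives is arbitrary; averages of equivalent functions
    coincide, so \<open>F\<close> does not depend on it, and this is why \<open>F\<close> is linear
    although \<open>r\<close> need not be.\<close>
  define r where "r X = (SOME f. f \<in> L \<and> X = cls f)" for X :: "((nat \<Rightarrow> 'a) \<Rightarrow> 'k) set"
  have r: "r X \<in> L \<and> X = cls (r X)" if "X \<in> vcarrier ?B" for X
    unfolding r_def by (rule someI_ex[of "\<lambda>f. f \<in> L \<and> X = cls f"]) (use that in \<open>blast elim: vcarrierE\<close>)
  have "r X \<in> L" if "X \<in> S" for X using r[of X] S(2) K that by blast
  then have "(\<lambda>X. weighted (r X)) ` S \<subseteq> Lp" by (auto intro: weighted_Lp)
  then obtain P where P: "finite_partition P"
    and close: "\<And>X. X \<in> S \<Longrightarrow> fnorm (\<lambda>x. weighted (r X) x - average P (weighted (r X)) x) < ennreal (\<epsilon> / 3)"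
    using ex_average_approximation[of "(\<lambda>X. weighted (r X)) ` S" "\<epsilon> / 3"] S(1) * by auto
  define F where "F X = cls (weighted_average P (r X))" for X
  have F: "F (cls f) = cls (weighted_average P f)" if f: "f \<in> L" for f
  proof -
    have "r (cls f) \<in> L" "cls f = cls (r (cls f))" using r[OF cls_in_vcarrier[OF f]] by auto
    then have "AE x in \<Omega>. f x = r (cls f) x" using f cls_eq_iff by blast
    then show ?thesis
      unfolding F_def using weighted_average_cong_AE[OF P f \<open>r (cls f) \<in> L\<close>] by simp
  qed
  have lin: "linear_operator ?B F"
    unfolding linear_operator_def
  proof (intro conjI ballI allI)
    show "F \<in> vcarrier ?B \<rightarrow> vcarrier ?B"
      by (auto elim!: vcarrierE simp: F intro!: cls_in_vcarrier weighted_average_L P)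
    show "F (vadd ?B X Y) = vadd ?B (F X) (F Y)" if "X \<in> vcarrier ?B" "Y \<in> vcarrier ?B" for X Y
      using that by (elim vcarrierE) (simp add: F vadd_cls L_add weighted_average_add P weighted_average_L)
    show "F (vscale ?B c X) = vscale ?B c (F X)" if "X \<in> vcarrier ?B" for X c
      using that by (elim vcarrierE) (simp add: F vscale_cls L_cmult weighted_average_cmult P weighted_average_L)
  qed
  have contr: "vnorm ?B (F X) \<le> vnorm ?B X" if "X \<in> vcarrier ?B" for X
    using that by (elim vcarrierE) (simp add: F vnorm_cls weighted_average_L P rnorm_weighted_average_le)
  have bdd: "bounded_operator ?B F"
    unfolding bounded_operator_def using contr by (intro exI[of _ 1]) auto
  have "finite_rank ?B F"
    unfolding finite_rank_def
  proof (intro exI[of _ "(\<lambda>b. cls (weighted_box b)) ` Pi\<^sub>E {1..n} P"] conjI subsetI)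
    show "finite ((\<lambda>b. cls (weighted_box b)) ` Pi\<^sub>E {1..n} P)" using finite_boxes[OF P] by simp
    show "X \<in> vcarrier ?B" if "X \<in> (\<lambda>b. cls (weighted_box b)) ` Pi\<^sub>E {1..n} P" for X
      using that by (auto intro!: cls_in_vcarrier weighted_box_L[OF P] simp del: Image_singleton_iff)
    fix Y assume "Y \<in> F ` vcarrier ?B"
    then obtain f where f: "f \<in> L" "Y = cls (weighted_average P f)" using F by (auto elim!: vcarrierE)
    show "Y \<in> vspan ?B ((\<lambda>b. cls (weighted_box b)) ` Pi\<^sub>E {1..n} P)"
      unfolding f weighted_average_eq_sum by (intro cls_sum_in_vspan weighted_box_L[OF P])
  qed
  moreover have "operator_norm ?B F \<le> 1"
    unfolding operator_norm_def
  proof (rule cSUP_least)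
    \<comment> \<open>The operator norm is a supremum of reals, to be bounded only over a nonempty
      set; the zero class witnesses that the unit ball is one.\<close>
    have "rnorm (\<lambda>_. 0 :: 'k) = 0" using rnorm_eq_0_iff[OF L_0] by simp
    then have "vzero ?B \<in> {X \<in> vcarrier B. vnorm ?B X \<le> 1}"
      by (simp add: vzero_B cls_in_vcarrier vnorm_cls L_0)
    then show "{X \<in> vcarrier B. vnorm ?B X \<le> 1} \<noteq> {}" by blast
    show "vnorm ?B (F X) \<le> 1" if "X \<in> {X \<in> vcarrier B. vnorm ?B X \<le> 1}" for X
      using that contr[of X] by simp
  qed
  moreover have "vnorm ?B (vdiff ?B X (F X)) < \<epsilon>" if X: "X \<in> K" for X
  proof -
    obtain Y where Y: "Y \<in> S" "X \<in> B.mball Y (\<epsilon> / 3)" using S(3) X by auto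
    define f where "f = r X"
    define g where "g = r Y"
    have f: "f \<in> L" "X = cls f" using r[of X] K X by (auto simp: f_def)
    have g: "g \<in> L" "Y = cls g" using r[of Y] K S(2) Y(1) by (auto simp: g_def)
    have "vdist ?B X Y < \<epsilon> / 3" using Y(2) B.commute by (auto simp: B.in_mball)
    then have fg: "fnorm (weighted (\<lambda>x. f x - g x)) < ennreal (\<epsilon> / 3)"
      using f g rnorm_less_iff[OF L_diff[OF f(1) g(1)], of "\<epsilon> / 3"] by (simp add: vdist_cls)
    have d: "(\<lambda>x. f x - weighted_average P f x) \<in> L"
      using f P by (intro L_diff weighted_average_L)
    have "fnorm (weighted (\<lambda>x. f x - weighted_average P f x)) = fnorm (\<lambda>x. weighted f x - average P (weighted f) x)"
      by (intro fnorm_cong) (simp add: weighted_average_error)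
    also have "\<dots> \<le> fnorm (\<lambda>x. weighted f x - weighted g x)
        + fnorm (\<lambda>x. weighted g x - average P (weighted g) x) + fnorm (\<lambda>x. weighted f x - weighted g x)"
      by (intro fnorm_average_error_le P weighted_Lp f g)
    also have "\<dots> < ennreal (\<epsilon> / 3) + ennreal (\<epsilon> / 3) + ennreal (\<epsilon> / 3)"
      using fg close[OF Y(1)] by (intro add_strict_mono) (auto simp: weighted_diff g_def)
    also have "\<dots> = ennreal \<epsilon>" using * by (simp flip: ennreal_plus)
    finally have "rnorm (\<lambda>x. f x - weighted_average P f x) < \<epsilon>"
      using d by (simp add: rnorm_less_iff)
    then show ?thesis
      using f d P by (simp add: F vdiff_cls weighted_average_L vnorm_cls)
  qed
  ultimately show "\<exists>F. linear_operator ?B F \<and> bounded_operator ?B F \<and> finite_rank ?B F \<and>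
      operator_norm ?B F \<le> 1 \<and> (\<forall>X\<in>K. vnorm ?B (vdiff ?B X (F X)) < \<epsilon>)"
    using lin bdd by blast
qed

end

section \<open>Independence of the measures at indices outside the product\<close>

lemma mixed_integral_cong_measure:
  assumes "\<And>i. i \<in> {1..k} \<Longrightarrow> M i = M' i"
  shows "mixed_integral M p w f k = mixed_integral M' p w f k"
  using assms
proof (induction k)
  case (Suc k)
  then have IH: "mixed_integral M p w f k = mixed_integral M' p w f k" and M: "M (Suc k) = M' (Suc k)" by auto
  show ?case
  proof (cases k)
    case 0
    then show ?thesis using M by (auto simp: fun_eq_iff One_nat_def)
  next
    case (Suc j)
    then show ?thesis using M IH by (auto simp: fun_eq_iff)
  qed
qed (simp add: fun_eq_iff)

lemma mixed_lp_space_cong_measure: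
  assumes M: "\<And>i. i \<in> {1..n} \<Longrightarrow> M i = M' i"
  shows "(mixed_lp_space n M p w :: ('k::real_normed_field, ((nat \<Rightarrow> 'a) \<Rightarrow> 'k) set) normed_structure) =
    mixed_lp_space n M' p w"
proof -
  have 1: "Pi\<^sub>M {1..n} M = Pi\<^sub>M {1..n} M'" using M by (intro PiM_cong) auto
  have 2: "mixed_norm n M p w = (mixed_norm n M' p w :: ((nat \<Rightarrow> 'a) \<Rightarrow> 'k) \<Rightarrow> ennreal)"
    by (rule ext) (simp only: mixed_norm_def mixed_integral_cong_measure[of n M M'] M)
  show ?thesis
    unfolding mixed_lp_space_def mixed_lp_rel_def mixed_lp_functions_def 1 2 ..
qed

theorem theorem2p3:
  fixes n :: nat
    and M :: "nat \<Rightarrow> 'a measure"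
    and p :: "nat \<Rightarrow> real"
    and w :: "(nat \<Rightarrow> 'a) \<Rightarrow> real"
    and v :: "nat \<Rightarrow> 'a \<Rightarrow> real"
    and \<L> :: "nat \<Rightarrow> 'a set set"
  assumes "n \<ge> 1"
    and "\<And>i. i \<in> {1..n} \<Longrightarrow> sigma_finite_measure (M i)"
    and "\<And>i. i \<in> {1..n} \<Longrightarrow> 1 \<le> p i"
    and "w \<in> borel_measurable (Pi\<^sub>M {1..n} M)"
    and "\<And>x. x \<in> space (Pi\<^sub>M {1..n} M) \<Longrightarrow> 0 < w x"
    and "\<And>j. j \<in> {1..n} \<Longrightarrow> local_sets (M j) (\<L> j)"
    and "\<And>j. j \<in> {1..n} \<Longrightarrow> weight (M j) (\<L> j) (v j)"
    and "\<And>x. x \<in> space (Pi\<^sub>M {1..n} M) \<Longrightarrow> w x \<le> (\<Prod>j\<in>{1..n}. v j (x j))"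
  shows "metric_approximation_property
    (mixed_lp_space n M p w ::
      ('k::{real_normed_field, banach, second_countable_topology},
       ((nat \<Rightarrow> 'a) \<Rightarrow> 'k) set) normed_structure)"
proof -
  \<comment> \<open>The locale demands \<sigma>-finiteness at every index, the theorem grants it
    only for \<open>1, ..., n\<close>. Elsewhere the measure is replaced by the one on the empty
    space, which changes neither the product nor the norm.\<close>
  define M' where "M' i = (if i \<in> {1..n} then M i else count_space {})" for i
  have M: "M i = M' i" if "i \<in> {1..n}" for i using that by (simp add: M'_def)
  have PiM: "Pi\<^sub>M {1..n} M = Pi\<^sub>M {1..n} M'" using M by (intro PiM_cong) auto
  have "sigma_finite_measure (M' i)" for i
    using assms(2) sigma_finite_measure_count_space_finite[of "{} :: 'a set"] by (simp add: M'_def)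
  then interpret weighted_mixed_exponents M' n p w
    by (intro weighted_mixed_exponents.intro mixed_exponents.intro product_sigma_finite.intro
        mixed_exponents_axioms.intro weighted_mixed_exponents_axioms.intro assms(1,3)
        assms(4,5)[unfolded PiM])
  have "mixed_lp_space n M p w = (mixed_lp_space n M' p w :: ('k, ((nat \<Rightarrow> 'a) \<Rightarrow> 'k) set) normed_structure)"
    by (rule mixed_lp_space_cong_measure) (rule M)
  then show ?thesis
    by (simp only: metric_approximation_property_B)
qed

end
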